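(* Let $\alpha\in(1,2]$, let $k$ be an even positive integer, and let $v\in H^{2\alpha}(\mathbb{R})$ be real-valued. Then $$\int_{\mathbb{R}}\rho[v]\,dx\int_{\mathbb{R}}\kappa[v]\,dx-\int_{\mathbb{R}} e[v]\,dx\int_{\mathbb{R}} j[v]\,dx\;\ge\;\frac{k^2}{2(k+2)^2}\left(\int_{\mathbb{R}} v^{k+2}\,dx\right)^2 .$$
   Context: $D^\beta f=(|\xi|^\beta\widehat f)^\vee$ is the fractional derivative and $H^s(\mathbb{R})$ the usual $L^2$-based Sobolev space. The mass density, mass current, energy density and energy current are $$\rho[v]=v^2,\qquad j[v]=(\alpha+1)\,vD^\alpha v+\frac{2(k+1)}{k+2}v^{k+2},$$ $$e[v]=\frac12 vD^\alpha v+\frac1{k+2}v^{k+2},\qquad \kappa[v]=\frac{\alpha+1}{2}vD^{2\alpha}v+\frac{\alpha+2}{2}v^{k+1}D^\alpha v+\frac12v^{2k+2}.$$ *)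

theory Defs
  imports "HOL-Analysis.Analysis"
begin

definition square_integrable :: "(real \<Rightarrow> complex) \<Rightarrow> bool" where
  "square_integrable f \<longleftrightarrow>
     f \<in> borel_measurable lborel \<and> integrable lborel (\<lambda>x. (cmod (f x))\<^sup>2)"

text \<open>
  The Fourier transform on the space of square-integrable functions, with the normalisation
  \<open>\<integral> e\<^bsup>-i x \<xi>\<^esup> f x dx\<close>: such an \<open>f\<close> need not be integrable, so its transform is the limit, in the
  \<open>L\<^sup>2\<close> norm, of the transforms of its truncations to \<open>[-R, R]\<close> (which are integrable). The limit
  always exists and is unique up to a null set; the functions \<open>fourier\<close> and \<open>inv_fourier\<close> select
  a representative.
\<close>

definition has_fourier :: "(real \<Rightarrow> complex) \<Rightarrow> (real \<Rightarrow> complex) \<Rightarrow> bool" where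
  "has_fourier f g \<longleftrightarrow> square_integrable f \<and> square_integrable g \<and>
     ((\<lambda>R. \<integral>\<^sup>+ \<xi>. ennreal ((cmod ((LINT x:{-R..R}|lborel. cis (- (x * \<xi>)) * f x) - g \<xi>))\<^sup>2) \<partial>lborel)
        \<longlongrightarrow> 0) at_top"

definition has_inv_fourier :: "(real \<Rightarrow> complex) \<Rightarrow> (real \<Rightarrow> complex) \<Rightarrow> bool" where
  "has_inv_fourier g f \<longleftrightarrow> square_integrable g \<and> square_integrable f \<and>
     ((\<lambda>R. \<integral>\<^sup>+ x. ennreal ((cmod (1 / (2 * of_real pi) *
              (LINT \<xi>:{-R..R}|lborel. cis (x * \<xi>) * g \<xi>) - f x))\<^sup>2) \<partial>lborel)
        \<longlongrightarrow> 0) at_top"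

definition fourier :: "(real \<Rightarrow> complex) \<Rightarrow> real \<Rightarrow> complex" where
  "fourier f = (SOME g. has_fourier f g)"

definition inv_fourier :: "(real \<Rightarrow> complex) \<Rightarrow> real \<Rightarrow> complex" where
  "inv_fourier g = (SOME f. has_inv_fourier g f)"

text \<open>For \<open>s \<ge> 0\<close>; only this range is meant.\<close>

definition sobolev :: "real \<Rightarrow> (real \<Rightarrow> complex) set" where
  "sobolev s = {f. square_integrable f \<and>
     square_integrable (\<lambda>\<xi>. of_real ((1 + \<xi>\<^sup>2) powr (s / 2)) * fourier f \<xi>)}"

definition frac_deriv :: "real \<Rightarrow> (real \<Rightarrow> complex) \<Rightarrow> real \<Rightarrow> complex" where
  "frac_deriv \<beta> f = inv_fourier (\<lambda>\<xi>. of_real (\<bar>\<xi>\<bar> powr \<beta>) * fourier f \<xi>)"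

text \<open>
  The multiplier \<open>\<bar>\<xi>\<bar> powr \<beta>\<close> is real and even, so the fractional derivative of a real-valued
  function is real almost everywhere; taking the real part below only adjusts types.
\<close>

definition frac_deriv_real :: "real \<Rightarrow> (real \<Rightarrow> real) \<Rightarrow> real \<Rightarrow> real" where
  "frac_deriv_real \<beta> v x = Re (frac_deriv \<beta> (\<lambda>y. complex_of_real (v y)) x)"

definition mass_density :: "(real \<Rightarrow> real) \<Rightarrow> real \<Rightarrow> real" where
  "mass_density v x = (v x)\<^sup>2"

definition mass_current :: "real \<Rightarrow> nat \<Rightarrow> (real \<Rightarrow> real) \<Rightarrow> real \<Rightarrow> real" where
  "mass_current \<alpha> k v x =
     (\<alpha> + 1) * v x * frac_deriv_real \<alpha> v x
     + 2 * (real k + 1) / (real k + 2) * v x ^ (k + 2)"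

definition energy_density :: "real \<Rightarrow> nat \<Rightarrow> (real \<Rightarrow> real) \<Rightarrow> real \<Rightarrow> real" where
  "energy_density \<alpha> k v x =
     1 / 2 * v x * frac_deriv_real \<alpha> v x + 1 / (real k + 2) * v x ^ (k + 2)"

definition energy_current :: "real \<Rightarrow> nat \<Rightarrow> (real \<Rightarrow> real) \<Rightarrow> real \<Rightarrow> real" where
  "energy_current \<alpha> k v x =
     (\<alpha> + 1) / 2 * v x * frac_deriv_real (2 * \<alpha>) v x
     + (\<alpha> + 2) / 2 * v x ^ (k + 1) * frac_deriv_real \<alpha> v x
     + 1 / 2 * v x ^ (2 * k + 2)"

end

theory Submission
  imports Defs "HOL-Probability.Probability" "HOL-Real_Asymp.Real_Asymp"
begin

text \<open>
  Put \<open>w = Re (D\<^sup>\<alpha> v)\<close>, \<open>p = v\<^bsup>k+1\<^esup>\<close>, \<open>M = \<integral> v\<^sup>2\<close>, \<open>A = \<integral> v w\<close>, \<open>B = \<integral> v p\<close> and \<open>s = sqrt (1 + \<alpha>)\<close>.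
  By Parseval \<open>A \<ge> 0\<close> and \<open>\<integral> v D\<^bsup>2\<alpha>\<^esup> v \<ge> \<integral> w\<^sup>2\<close>, so the energy current integrates to at least
  \<open>\<integral> (s w + p)\<^sup>2 / 2 + (s - 1)\<^sup>2 / 2 * \<integral> p w\<close>. Once \<open>\<integral> p w \<ge> 0\<close> is known, the Cauchy-Schwarz inequality for
  \<open>v\<close> and \<open>s w + p\<close> bounds its product with \<open>M\<close> below by \<open>(s A + B)\<^sup>2 / 2\<close>. Subtracting the other product
  and the claimed lower bound leaves exactly \<open>(s - 1) (k + 1 - s) / (k + 2) A B\<close>, which is nonnegative since \<open>1 \<le> s \<le> 2\<close>.

  For the positivity of \<open>\<integral> p w\<close>, the symbol \<open>\<bar>\<xi>\<bar> powr \<alpha>\<close> is a positive superposition of the symbols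
  \<open>1 - cos (t \<xi>)\<close> (a limit of multiples of them if \<open>\<alpha> = 2\<close>), and for each \<open>t\<close> the correlation
  \<open>\<integral> p(x) (v(x) - (v(x + t) + v(x - t)) / 2) dx\<close> is nonnegative, because \<open>a \<mapsto> a\<^bsup>k+1\<^esup>\<close> is increasing.

  The Plancherel theory rests on inserting the factor \<open>exp (- (e \<xi>)\<^sup>2 / 2)\<close> into \<open>\<integral> FT f(\<xi>) FT h(-\<xi>) d\<xi>\<close> and letting
  \<open>e\<close> tend to \<open>0\<close>.
\<close>

subsection \<open>The Fourier integral\<close>

text \<open>The classical transform, defined pointwise and meant for integrable functions; elsewhere
  the Bochner integral takes its default value 0. It is kept apart from \<open>fourier\<close>,
  which only selects a representative of an L2 limit.\<close>

definition FT :: "(real \<Rightarrow> complex) \<Rightarrow> real \<Rightarrow> complex" where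
  "FT f \<xi> = (LINT x|lborel. cis (- (x * \<xi>)) * f x)"

lemma borel_measurable_cis [measurable]: "cis \<in> borel_measurable borel"
  by (intro borel_measurable_continuous_onI continuous_intros)

lemma FT_measurable [measurable]:
  assumes [measurable]: "f \<in> borel_measurable borel"
  shows "FT f \<in> borel_measurable borel"
  unfolding FT_def by measurable

lemma integrable_cis_mult:
  fixes f :: "real \<Rightarrow> complex" and \<theta> :: "real \<Rightarrow> real"
  assumes "integrable lborel f" and [measurable]: "\<theta> \<in> borel_measurable borel"
  shows "integrable lborel (\<lambda>x. cis (\<theta> x) * f x)"
proof -
  have [measurable]: "f \<in> borel_measurable borel" using assms(1) by auto
  show ?thesis
    by (rule Bochner_Integration.integrable_bound[OF assms(1)]) (auto simp: norm_mult)
qed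

lemma norm_FT_le: "norm (FT f \<xi>) \<le> (LINT x|lborel. norm (f x))"
  unfolding FT_def using integral_norm_bound[of lborel "\<lambda>x. cis (- (x * \<xi>)) * f x"]
  by (simp add: norm_mult)

lemma FT_diff:
  assumes "integrable lborel f" "integrable lborel g"
  shows "FT (\<lambda>x. f x - g x) \<xi> = FT f \<xi> - FT g \<xi>"
  unfolding FT_def using assms
  by (simp add: right_diff_distrib integrable_cis_mult)

lemma integrable_bounded_mult:
  fixes f h :: "real \<Rightarrow> complex"
  assumes "integrable lborel f" and [measurable]: "h \<in> borel_measurable borel"
    and "\<And>x. norm (h x) \<le> B"
  shows "integrable lborel (\<lambda>x. h x * f x)"
proof -
  have [measurable]: "f \<in> borel_measurable borel" using assms(1) by auto
  have "integrable lborel (\<lambda>x. complex_of_real B * f x)" using assms(1) by simp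
  then show ?thesis
  proof (rule Bochner_Integration.integrable_bound, goal_cases)
    case 2
    have "0 \<le> B" using assms(3)[of 0] norm_ge_zero order_trans by blast
    then show ?case using assms(3) by (auto simp: norm_mult intro!: mult_right_mono)
  qed measurable
qed

lemma integrable_FT_mult:
  assumes "integrable lborel f" and "integrable lborel h"
  shows "integrable lborel (\<lambda>\<xi>. FT f \<xi> * h \<xi>)"
  using assms by (intro integrable_bounded_mult[OF assms(2) _ norm_FT_le]) auto

text \<open>The kernel \<open>cis (- (x * \<xi>))\<close> is symmetric in its two variables and has
  modulus 1, so this is Fubini for the integrable product \<open>f x * h \<xi>\<close>.\<close>

lemma FT_exchange:
  assumes f: "integrable lborel f" and h: "integrable lborel h"
  shows "(LINT \<xi>|lborel. FT f \<xi> * h \<xi>) = (LINT x|lborel. f x * FT h x)"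
proof -
  have [measurable]: "f \<in> borel_measurable borel" "h \<in> borel_measurable borel"
    using f h by auto
  have "integrable (lborel \<Otimes>\<^sub>M lborel) (\<lambda>(x, \<xi>). cis (- (x * \<xi>)) * f x * h \<xi>)"
  proof (rule lborel_pair.Fubini_integrable, goal_cases)
    case 2
    show ?case using f by (simp add: norm_mult)
  next
    case 3
    show ?case using h by (auto simp: mult.assoc intro!: AE_I2 integrable_cis_mult)
  qed measurable
  from lborel_pair.Fubini_integral[OF this]
  show ?thesis unfolding FT_def
    by (simp add: mult_ac flip: Bochner_Integration.integral_mult_right_zero)
qed

lemma FT_reflect: "FT f (- \<xi>) = FT (\<lambda>x. f (- x)) \<xi>"
  unfolding FT_def
  by (subst lborel_integral_real_affine[where c="-1" and t=0]) simp_all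

lemma FT_cnj: "FT (\<lambda>x. cnj (f x)) (- \<xi>) = cnj (FT f \<xi>)"
  unfolding FT_def by (subst Bochner_Integration.integral_cnj[symmetric]) (simp add: cis_cnj)

text \<open>After rescaling by \<open>e\<close> the integral is the characteristic function of the
  standard normal distribution. The right-hand side is written as a normal density of width
  \<open>e\<close>, so that it can act as an approximate identity.\<close>

lemma FT_gaussian:
  assumes "0 < e"
  shows "FT (\<lambda>\<xi>. of_real (exp (- (e * \<xi>)\<^sup>2 / 2))) x = of_real (2 * pi / e * std_normal_density (x / e))"
proof -
  have "FT (\<lambda>\<xi>. of_real (exp (- (e * \<xi>)\<^sup>2 / 2))) x = 
    sqrt (2 * pi) * (LINT \<xi>|lborel. cis (- (\<xi> * x)) * of_real (std_normal_density (e * \<xi>)))"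
    unfolding FT_def by (subst integral_mult_right_zero[symmetric])
      (simp add: std_normal_density_def field_simps)
  also have "\<dots> = sqrt (2 * pi) / e * (LINT z|lborel. iexp (- x / e * z) * of_real (std_normal_density z))"
    using assms
    by (subst (2) lborel_integral_real_affine[where c=e and t=0]) (simp_all add: cis_conv_exp field_simps scaleR_conv_of_real)
  also have "(LINT z|lborel. iexp (- x / e * z) * of_real (std_normal_density z))
    = char std_normal_distribution (- x / e)"
    unfolding char_def by (subst integral_density) (simp_all add: scaleR_conv_of_real mult.commute)
  also have "\<dots> = of_real (exp (- (- x / e)\<^sup>2 / 2))"
    by (simp only: char_std_normal_distribution)
  finally have "FT (\<lambda>\<xi>. of_real (exp (- (e * \<xi>)\<^sup>2 / 2))) x =
      of_real (sqrt (2 * pi) / e * exp (- (- x / e)\<^sup>2 / 2))"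
    by simp
  also have "sqrt (2 * pi) / e * exp (- (- x / e)\<^sup>2 / 2) = 2 * pi / e * std_normal_density (x / e)"
  proof -
    define q where "q = sqrt (2 * pi)"
    have q: "q > 0" "2 * pi = q * q" by (simp_all add: q_def)
    show ?thesis
      unfolding std_normal_density_def q_def[symmetric] q(2) using q(1) by (simp add: field_simps)
  qed
  finally show ?thesis .
qed

lemma integrable_gaussian:
  assumes "0 < e"
  shows "integrable lborel (\<lambda>\<xi>. complex_of_real (exp (- (e * \<xi>)\<^sup>2 / 2)))"
proof -
  have "integrable lborel (\<lambda>x. sqrt (2 * pi) * std_normal_density (0 + e * x))"
    using assms by (intro integrable_mult_right lborel_integrable_real_affine) auto
  then show ?thesis by (simp add: std_normal_density_def field_simps)
qed

text \<open>On the space side the Gaussian factor becomes an average of \<open>h\<close> around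
  \<open>x\<close> at scale \<open>e\<close>. Letting \<open>e\<close> tend to 0 then leads to
  Parseval's identity; the argument \<open>- \<xi>\<close> makes the limit pair \<open>f x\<close>
  with \<open>h x\<close> and not with \<open>h (- x)\<close>.\<close>

lemma gaussian_regularised_pairing:
  fixes f h :: "real \<Rightarrow> complex"
  assumes e: "0 < e" and f: "integrable lborel f" and h: "integrable lborel h"
  shows "(LINT \<xi>|lborel. of_real (exp (- (e * \<xi>)\<^sup>2 / 2)) * FT f \<xi> * FT h (- \<xi>)) =
    2 * pi * (LINT x|lborel. f x * (LINT z|lborel. of_real (std_normal_density z) * h (x - e * z)))"
proof -
  let ?\<gamma> = "\<lambda>\<xi>. complex_of_real (exp (- (e * \<xi>)\<^sup>2 / 2))"
  have hr: "integrable lborel (\<lambda>x. h (- x))"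
    using lborel_integrable_real_affine[OF h, of "-1" 0] by simp
  have \<gamma>c: "integrable lborel (\<lambda>\<xi>. cis (- (x * \<xi>)) * ?\<gamma> \<xi>)" for x
    using integrable_cis_mult[OF integrable_gaussian[OF e], of "\<lambda>\<xi>. - (x * \<xi>)"] by simp
  have i: "integrable lborel (\<lambda>\<xi>. FT h (- \<xi>) * ?\<gamma> \<xi>)"
    unfolding FT_reflect by (rule integrable_FT_mult[OF hr integrable_gaussian[OF e]])
  have "FT (\<lambda>\<xi>. FT h (- \<xi>) * ?\<gamma> \<xi>) x =
      2 * pi * (LINT z|lborel. of_real (std_normal_density z) * h (x - e * z))" for x
  proof -
    have "FT (\<lambda>\<xi>. FT h (- \<xi>) * ?\<gamma> \<xi>) x = (LINT \<xi>|lborel. FT (\<lambda>x. h (- x)) \<xi> * (cis (- (x * \<xi>)) * ?\<gamma> \<xi>))"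
      unfolding FT_reflect FT_def[of "\<lambda>\<xi>. FT _ \<xi> * _ \<xi>"] by (simp add: mult_ac)
    also have "\<dots> = (LINT y|lborel. h (- y) * FT (\<lambda>\<xi>. cis (- (x * \<xi>)) * ?\<gamma> \<xi>) y)"
      by (rule FT_exchange[OF hr \<gamma>c])
    \<comment> \<open>Modulating the Gaussian shifts its transform by \<open>x\<close>.\<close>
    also have "(\<lambda>y. FT (\<lambda>\<xi>. cis (- (x * \<xi>)) * ?\<gamma> \<xi>) y) = (\<lambda>y. FT ?\<gamma> (x + y))"
      unfolding FT_def by (auto simp: cis_mult algebra_simps simp flip: mult.assoc)
    \<comment> \<open>Substitute \<open>y = e * z - x\<close>; the Jacobian \<open>e\<close> cancels
      the factor \<open>1 / e\<close> of the rescaled density.\<close>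
    also have "(LINT y|lborel. h (- y) * FT ?\<gamma> (x + y)) =
        e * (LINT z|lborel. h (x - e * z) * of_real (2 * pi / e * std_normal_density z))"
      unfolding FT_gaussian[OF e] using e
      by (subst lborel_integral_real_affine[where c=e and t="-x"]) (simp_all add: scaleR_conv_of_real)
    also have "\<dots> = 2 * pi * (LINT z|lborel. of_real (std_normal_density z) * h (x - e * z))"
      using e by (subst (1 2) integral_mult_right_zero[symmetric]) (simp add: field_simps)
    finally show ?thesis .
  qed
  then show ?thesis
    using FT_exchange[OF f i] by (simp add: mult_ac flip: integral_mult_right_zero)
qed

subsection \<open>Square-integrable functions and Bessel's inequality\<close>

text \<open>The squared L2 norm, taken in \<open>ennreal\<close> so that it is infinite, and not 0
  by default, for a measurable function that is not square integrable.\<close>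

definition l2sq :: "(real \<Rightarrow> complex) \<Rightarrow> ennreal" where
  "l2sq f = (\<integral>\<^sup>+ x. ennreal ((cmod (f x))\<^sup>2) \<partial>lborel)"

definition trunc :: "real \<Rightarrow> (real \<Rightarrow> complex) \<Rightarrow> real \<Rightarrow> complex" where
  "trunc R f x = indicator {-R..R} x *\<^sub>R f x"

lemma square_integrable_iff:
  "square_integrable f \<longleftrightarrow> f \<in> borel_measurable borel \<and> l2sq f < \<infinity>"
  unfolding square_integrable_def l2sq_def
  by (auto simp: integrable_iff_bounded)

lemma square_integrable_measurable [dest]:
  "square_integrable f \<Longrightarrow> f \<in> borel_measurable borel"
  by (simp add: square_integrable_iff)

lemma l2sq_eq:
  assumes "square_integrable f"
  shows "l2sq f = ennreal (LINT x|lborel. (cmod (f x))\<^sup>2)"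
  using assms unfolding square_integrable_def l2sq_def
  by (intro nn_integral_eq_integral) auto

lemma l2sq_add_le:
  assumes [measurable]: "f \<in> borel_measurable borel" "g \<in> borel_measurable borel"
  shows "l2sq (\<lambda>x. f x + g x) \<le> 2 * l2sq f + 2 * l2sq g"
proof -
  have "(cmod (f x + g x))\<^sup>2 \<le> 2 * (cmod (f x))\<^sup>2 + 2 * (cmod (g x))\<^sup>2" for x
  proof -
    have "(cmod (f x + g x))\<^sup>2 \<le> (cmod (f x) + cmod (g x))\<^sup>2"
      by (intro power_mono norm_triangle_ineq) simp
    also have "\<dots> \<le> 2 * (cmod (f x))\<^sup>2 + 2 * (cmod (g x))\<^sup>2"
      using sum_squares_bound[of "cmod (f x)" "cmod (g x)"] by (simp add: power2_sum)
    finally show ?thesis .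
  qed
  then have "l2sq (\<lambda>x. f x + g x) \<le>
      (\<integral>\<^sup>+ x. 2 * ennreal ((cmod (f x))\<^sup>2) + 2 * ennreal ((cmod (g x))\<^sup>2) \<partial>lborel)"
    unfolding l2sq_def
    by (intro nn_integral_mono, rule order_trans[OF ennreal_leI]) (auto simp: ennreal_mult)
  also have "\<dots> = 2 * l2sq f + 2 * l2sq g"
    unfolding l2sq_def by (subst nn_integral_add) (auto simp: nn_integral_cmult)
  finally show ?thesis .
qed

lemma square_integrable_add:
  assumes "square_integrable f" "square_integrable g"
  shows "square_integrable (\<lambda>x. f x + g x)"
proof -
  have "2 * l2sq f + 2 * l2sq g < \<infinity>"
    using assms by (auto simp: square_integrable_iff ennreal_mult_less_top)
  then show ?thesis using l2sq_add_le[of f g] assms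
    by (auto simp: square_integrable_iff intro: order_le_less_trans)
qed

lemma square_integrable_bound:
  assumes "square_integrable f" and [measurable]: "g \<in> borel_measurable borel"
    and "AE x in lborel. cmod (g x) \<le> cmod (f x)"
  shows "square_integrable g"
proof -
  have "l2sq g \<le> l2sq f"
    unfolding l2sq_def using assms(3)
    by (intro nn_integral_mono_AE) (auto simp: power_mono elim: eventually_mono)
  then show ?thesis using assms by (auto simp: square_integrable_iff)
qed

lemma square_integrable_cmult:
  assumes "square_integrable f"
  shows "square_integrable (\<lambda>x. c * f x)"
  using assms unfolding square_integrable_def by (auto simp: norm_mult power_mult_distrib)

lemma square_integrable_diff:
  assumes "square_integrable f" "square_integrable g"
  shows "square_integrable (\<lambda>x. f x - g x)"
  using square_integrable_add[OF assms(1) square_integrable_cmult[OF assms(2), of "-1"]] by simp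

lemma integrable_mult_square_integrable:
  assumes "square_integrable f" "square_integrable g"
  shows "integrable lborel (\<lambda>x. f x * g x)"
proof (rule Bochner_Integration.integrable_bound)
  show "integrable lborel (\<lambda>x. (cmod (f x))\<^sup>2 + (cmod (g x))\<^sup>2)"
    using assms by (auto simp: square_integrable_def)
  show "AE x in lborel. norm (f x * g x) \<le> norm ((cmod (f x))\<^sup>2 + (cmod (g x))\<^sup>2)"
  proof (rule AE_I2)
    fix x show "norm (f x * g x) \<le> norm ((cmod (f x))\<^sup>2 + (cmod (g x))\<^sup>2)"
      using sum_squares_bound[of "cmod (f x)" "cmod (g x)"] mult_nonneg_nonneg[of "cmod (f x)" "cmod (g x)"]
      unfolding norm_mult real_norm_def by linarith
  qed
qed (use assms in \<open>auto intro!: borel_measurable_times\<close>)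

lemma Cauchy_Schwarz_l2sq:
  assumes [measurable]: "f \<in> borel_measurable borel" "g \<in> borel_measurable borel"
  shows "(ennreal (cmod (LINT x|lborel. f x * g x)))\<^sup>2 \<le> l2sq f * l2sq g"
proof -
  \<comment> \<open>If the product is not integrable, its integral is 0 by default and the bound
    still holds; hence measurability suffices.\<close>
  have "ennreal (cmod (LINT x|lborel. f x * g x)) \<le> (\<integral>\<^sup>+ x. ennreal (cmod (f x * g x)) \<partial>lborel)"
    by (cases "integrable lborel (\<lambda>x. f x * g x)")
      (auto intro!: integral_norm_bound_ennreal simp: not_integrable_integral_eq)
  then have "(ennreal (cmod (LINT x|lborel. f x * g x)))\<^sup>2 \<le>
      (\<integral>\<^sup>+ x. ennreal (cmod (f x)) * ennreal (cmod (g x)) \<partial>lborel)\<^sup>2"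
    by (intro power_mono) (auto simp: norm_mult ennreal_mult)
  also have "\<dots> \<le> l2sq f * l2sq g"
    unfolding l2sq_def
    using Cauchy_Schwarz_nn_integral[of "\<lambda>x. ennreal (cmod (f x))" lborel "\<lambda>x. ennreal (cmod (g x))"]
    by (simp add: ennreal_power)
  finally show ?thesis .
qed

text \<open>Norm convergence implies weak convergence, by Cauchy-Schwarz. Identities proved for
  truncations are carried over to their L2 limits in this way.\<close>

lemma tendsto_integral_l2sq:
  assumes F: "\<And>R. square_integrable (F R)" and g: "square_integrable g" and h: "square_integrable h"
    and lim: "((\<lambda>R. l2sq (\<lambda>x. F R x - g x)) \<longlongrightarrow> 0) A"
  shows "((\<lambda>R. LINT x|lborel. F R x * h x) \<longlongrightarrow> (LINT x|lborel. g x * h x)) A"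
proof -
  define D where "D R = cmod ((LINT x|lborel. F R x * h x) - (LINT x|lborel. g x * h x))" for R
  have *: "ennreal ((D R)\<^sup>2) \<le> l2sq (\<lambda>x. F R x - g x) * l2sq h" for R
  proof -
    have "D R = cmod (LINT x|lborel. (F R x - g x) * h x)"
      using F g h by (simp add: D_def left_diff_distrib integrable_mult_square_integrable)
    moreover have "(\<lambda>x. F R x - g x) \<in> borel_measurable borel" "h \<in> borel_measurable borel"
      using F[of R] g h by (auto intro!: borel_measurable_diff)
    ultimately show ?thesis using Cauchy_Schwarz_l2sq[of "\<lambda>x. F R x - g x" h]
      by (simp add: ennreal_power)
  qed
  have "((\<lambda>R. l2sq (\<lambda>x. F R x - g x) * l2sq h) \<longlongrightarrow> 0 * l2sq h) A"
    using h by (intro tendsto_mult_ennreal lim tendsto_const) (auto simp: square_integrable_iff)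
  then have "((\<lambda>R. l2sq (\<lambda>x. F R x - g x) * l2sq h) \<longlongrightarrow> ennreal 0) A" by simp
  then have "((\<lambda>R. ennreal ((D R)\<^sup>2)) \<longlongrightarrow> ennreal 0) A"
  proof (rule tendsto_sandwich[where f="\<lambda>_. ennreal 0", rotated -1])
    show "\<forall>\<^sub>F R in A. ennreal ((D R)\<^sup>2) \<le> l2sq (\<lambda>x. F R x - g x) * l2sq h"
      by (intro always_eventually allI *)
    show "\<forall>\<^sub>F R in A. ennreal 0 \<le> ennreal ((D R)\<^sup>2)" by simp
  qed (rule tendsto_const)
  then have "((\<lambda>R. (D R)\<^sup>2) \<longlongrightarrow> 0) A"
    by (rule tendsto_ennrealD) simp_all
  then have "((\<lambda>R. sqrt ((D R)\<^sup>2)) \<longlongrightarrow> sqrt 0) A"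
    by (rule tendsto_real_sqrt)
  then have "(D \<longlongrightarrow> 0) A" by (simp add: D_def[abs_def])
  then show ?thesis
    unfolding D_def by (simp only: tendsto_norm_zero_iff LIM_zero_iff)
qed

text \<open>Fatou's lemma against a fixed bound: a norm estimate passes to an almost everywhere
  limit without any dominating function.\<close>

lemma Fatou_bound:
  fixes f :: "nat \<Rightarrow> 'a \<Rightarrow> ennreal"
  assumes [measurable]: "\<And>n. f n \<in> borel_measurable M"
    and lim: "AE x in M. (\<lambda>n. f n x) \<longlonglongrightarrow> g x"
    and le: "\<forall>\<^sub>F n in sequentially. (\<integral>\<^sup>+ x. f n x \<partial>M) \<le> C"
  shows "(\<integral>\<^sup>+ x. g x \<partial>M) \<le> C"
proof -
  have "(\<integral>\<^sup>+ x. g x \<partial>M) = (\<integral>\<^sup>+ x. liminf (\<lambda>n. f n x) \<partial>M)"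
    using lim by (intro nn_integral_cong_AE) (auto simp: lim_imp_Liminf elim!: eventually_mono)
  also have "\<dots> \<le> liminf (\<lambda>n. \<integral>\<^sup>+ x. f n x \<partial>M)" by (rule nn_integral_liminf) auto
  also have "\<dots> \<le> limsup (\<lambda>n. \<integral>\<^sup>+ x. f n x \<partial>M)" by (rule Liminf_le_Limsup) simp
  also have "\<dots> \<le> C" using le by (rule Limsup_bounded)
  finally show ?thesis .
qed

text \<open>Bound the product \<open>f x * f (x - e * z)\<close> by half the sum of the squared
  moduli. The normal density has total mass 1 and the norm is invariant under translation, so by
  Tonelli each half contributes half of \<open>l2sq f\<close>.\<close>

lemma gaussian_bilinear_le:
  assumes [measurable]: "f \<in> borel_measurable borel"
  shows "ennreal (cmod (LINT x|lborel. f x * (LINT z|lborel. of_real (std_normal_density z) * cnj (f (x - e * z)))))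
    \<le> l2sq f"
proof -
  let ?n = "std_normal_density"
  define c :: real where "c = 1 / 2"
  have c: "0 \<le> c" "c + c = 1" by (simp_all add: c_def)
  have I: "ennreal (cmod (LINT x|lborel. k x)) \<le> (\<integral>\<^sup>+ x. ennreal (cmod (k x)) \<partial>lborel)" for k :: "real \<Rightarrow> complex"
    by (cases "integrable lborel k")
      (auto intro!: integral_norm_bound_ennreal simp: not_integrable_integral_eq)
  have n1: "(\<integral>\<^sup>+ z. ennreal (?n z) \<partial>lborel) = 1"
    using prob_space.emeasure_space_1[OF prob_space_normal_density[of 1 0]]
    by (simp add: emeasure_density)
  have shift: "(\<integral>\<^sup>+ x. ennreal ((cmod (f (x - c)))\<^sup>2) \<partial>lborel) = l2sq f" for c
    unfolding l2sq_def by (subst (2) nn_integral_real_affine[where c=1 and t="-c"]) (auto simp: add.commute)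
  have "ennreal (cmod (LINT x|lborel. f x * (LINT z|lborel. of_real (?n z) * cnj (f (x - e * z)))))
     \<le> (\<integral>\<^sup>+ x. ennreal (cmod (f x * (LINT z|lborel. of_real (?n z) * cnj (f (x - e * z))))) \<partial>lborel)"
    by (rule I)
  also have "\<dots> \<le> (\<integral>\<^sup>+ x. (\<integral>\<^sup>+ z. ennreal (cmod (f x)) * (ennreal (?n z) * ennreal (cmod (f (x - e * z)))) \<partial>lborel) \<partial>lborel)"
    by (auto simp: norm_mult ennreal_mult nn_integral_cmult
        intro!: nn_integral_mono mult_left_mono order_trans[OF I])
  also have "\<dots> \<le> (\<integral>\<^sup>+ x. (\<integral>\<^sup>+ z. ennreal (?n z) * (ennreal c * ennreal ((cmod (f x))\<^sup>2)) + ennreal (?n z) * (ennreal c * ennreal ((cmod (f (x - e * z)))\<^sup>2)) \<partial>lborel) \<partial>lborel)"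
  proof (intro nn_integral_mono)
    fix x z :: real
    have "cmod (f x) * cmod (f (x - e * z)) \<le> c * (cmod (f x))\<^sup>2 + c * (cmod (f (x - e * z)))\<^sup>2"
      using sum_squares_bound[of "cmod (f x)" "cmod (f (x - e * z))"] by (simp add: c_def)
    then have "?n z * (cmod (f x) * cmod (f (x - e * z))) \<le> ?n z * (c * (cmod (f x))\<^sup>2 + c * (cmod (f (x - e * z)))\<^sup>2)"
      by (intro mult_left_mono) auto
    then show "ennreal (cmod (f x)) * (ennreal (?n z) * ennreal (cmod (f (x - e * z))))
      \<le> ennreal (?n z) * (ennreal c * ennreal ((cmod (f x))\<^sup>2)) + ennreal (?n z) * (ennreal c * ennreal ((cmod (f (x - e * z)))\<^sup>2))"
      using c by (simp add: algebra_simps flip: ennreal_mult ennreal_plus)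
  qed
  also have "\<dots> = (\<integral>\<^sup>+ x. (ennreal c * ennreal ((cmod (f x))\<^sup>2)) \<partial>lborel) + 
     (\<integral>\<^sup>+ x. (\<integral>\<^sup>+ z. ennreal (?n z) * (ennreal c * ennreal ((cmod (f (x - e * z)))\<^sup>2)) \<partial>lborel) \<partial>lborel)"
    by (simp add: nn_integral_add nn_integral_multc n1)
  also have "(\<integral>\<^sup>+ x. (\<integral>\<^sup>+ z. ennreal (?n z) * (ennreal c * ennreal ((cmod (f (x - e * z)))\<^sup>2)) \<partial>lborel) \<partial>lborel)
     = (\<integral>\<^sup>+ z. ennreal (?n z) * (\<integral>\<^sup>+ x. (ennreal c * ennreal ((cmod (f (x - e * z)))\<^sup>2)) \<partial>lborel) \<partial>lborel)"
    by (subst lborel_pair.Fubini') (auto simp: nn_integral_cmult)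
  also have "\<dots> = (\<integral>\<^sup>+ z. ennreal (?n z) * (ennreal c * l2sq f) \<partial>lborel)"
    by (subst nn_integral_cmult) (simp_all add: shift)
  also have "\<dots> = ennreal c * l2sq f" by (simp add: nn_integral_multc n1)
  also have "(\<integral>\<^sup>+ x. (ennreal c * ennreal ((cmod (f x))\<^sup>2)) \<partial>lborel) = ennreal c * l2sq f"
    unfolding l2sq_def by (rule nn_integral_cmult) simp
  also have "ennreal c * l2sq f + ennreal c * l2sq f = l2sq f"
    using c by (simp add: distrib_right[symmetric] flip: ennreal_plus)
  finally show ?thesis .
qed

lemma borel_measurable_cnj [measurable]: "cnj \<in> borel_measurable borel"
  by (intro borel_measurable_continuous_onI continuous_intros)

text \<open>This half of Plancherel's theorem is what makes the transforms of truncations a Cauchy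
  family, and it later bounds the norm of an inverse transform. If \<open>f\<close> is not square
  integrable the right-hand side is infinite.\<close>

lemma l2sq_FT_le:
  assumes f: "integrable lborel f"
  shows "l2sq (FT f) \<le> ennreal (2 * pi) * l2sq f"
proof -
  have [measurable]: "f \<in> borel_measurable borel" using f by auto
  let ?\<gamma> = "\<lambda>n \<xi>. exp (- (1 / Suc n * \<xi>)\<^sup>2 / 2) :: real"
  \<comment> \<open>The regularised integral is a Gaussian average of the correlations \<open>\<integral> f(x) cnj f(x - y) dx\<close>, each of modulus at most \<open>l2sq f\<close>.\<close>
  have *: "(\<integral>\<^sup>+ \<xi>. ennreal (?\<gamma> n \<xi> * (cmod (FT f \<xi>))\<^sup>2) \<partial>lborel) \<le> ennreal (2 * pi) * l2sq f" for n
  proof -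
    have e: "0 < 1 / real (Suc n)" by simp
    have "integrable lborel (\<lambda>\<xi>. ((FT f \<xi> * cnj (FT f \<xi>)) * of_real (?\<gamma> n \<xi>)))"
    proof (rule integrable_bounded_mult[OF integrable_gaussian[OF e]])
      show "norm (FT f \<xi> * cnj (FT f \<xi>)) \<le> (LINT x|lborel. norm (f x)) * (LINT x|lborel. norm (f x))" for \<xi>
        by (auto simp: norm_mult intro!: mult_mono norm_FT_le)
    qed measurable
    then have i: "integrable lborel (\<lambda>\<xi>. complex_of_real (?\<gamma> n \<xi> * (cmod (FT f \<xi>))\<^sup>2))"
      unfolding of_real_mult complex_norm_square by (simp only: mult_ac)
    have "(LINT \<xi>|lborel. complex_of_real (?\<gamma> n \<xi> * (cmod (FT f \<xi>))\<^sup>2)) =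
       (LINT \<xi>|lborel. of_real (?\<gamma> n \<xi>) * FT f \<xi> * FT (\<lambda>x. cnj (f x)) (- \<xi>))"
      unfolding of_real_mult complex_norm_square FT_cnj by (simp only: mult_ac)
    also have "\<dots> = 2 * pi * (LINT x|lborel. f x * (LINT z|lborel. of_real (std_normal_density z) * cnj (f (x - 1 / Suc n * z))))"
      by (rule gaussian_regularised_pairing[OF e f]) (use f in simp)
    finally have eq: "cmod (LINT \<xi>|lborel. complex_of_real (?\<gamma> n \<xi> * (cmod (FT f \<xi>))\<^sup>2)) =
       2 * pi * cmod (LINT x|lborel. f x * (LINT z|lborel. of_real (std_normal_density z) * cnj (f (x - 1 / Suc n * z))))"
      by (simp only: norm_mult) (simp add: norm_mult)
    have "(\<integral>\<^sup>+ \<xi>. ennreal (?\<gamma> n \<xi> * (cmod (FT f \<xi>))\<^sup>2) \<partial>lborel) = ennreal (LINT \<xi>|lborel. ?\<gamma> n \<xi> * (cmod (FT f \<xi>))\<^sup>2)"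
      using i unfolding complex_of_real_integrable_eq by (intro nn_integral_eq_integral) auto
    also have "(LINT \<xi>|lborel. ?\<gamma> n \<xi> * (cmod (FT f \<xi>))\<^sup>2) = cmod (LINT \<xi>|lborel. complex_of_real (?\<gamma> n \<xi> * (cmod (FT f \<xi>))\<^sup>2))"
      unfolding integral_complex_of_real by (simp add: integral_nonneg)
    finally show ?thesis unfolding eq
      using gaussian_bilinear_le[of f "1 / Suc n"]
      by (simp add: ennreal_mult mult_left_mono)
  qed
  have "(\<integral>\<^sup>+ \<xi>. ennreal ((cmod (FT f \<xi>))\<^sup>2) \<partial>lborel) \<le> ennreal (2 * pi) * l2sq f"
  \<comment> \<open>The Gaussian factors tend to 1. Integrability of the squared transform is not
    yet known, so the limit is taken by Fatou and not by dominated convergence.\<close>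
  proof (rule Fatou_bound)
    have "(\<lambda>n. ennreal (?\<gamma> n \<xi> * (cmod (FT f \<xi>))\<^sup>2)) \<longlonglongrightarrow> ennreal (exp (- (0 * \<xi>)\<^sup>2 / 2) * (cmod (FT f \<xi>))\<^sup>2)" for \<xi>
      by (intro tendsto_intros LIMSEQ_inverse_real_of_nat[unfolded inverse_eq_divide]) auto
    then show "AE \<xi> in lborel. (\<lambda>n. ennreal (?\<gamma> n \<xi> * (cmod (FT f \<xi>))\<^sup>2)) \<longlonglongrightarrow> ennreal ((cmod (FT f \<xi>))\<^sup>2)"
      by simp
  qed (use * in auto)
  then show ?thesis by (simp add: l2sq_def[of "FT f"])
qed

subsection \<open>The Fourier transform on square-integrable functions\<close>

text \<open>Riesz-Fischer in quantitative form: \<open>g\<close> is an almost everywhere limit along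
  a subsequence, and Fatou turns the Cauchy bound \<open>\<tau> R\<close> into a bound for the
  distance of \<open>F R\<close> from \<open>g\<close>.\<close>

lemma L2_complete:
  fixes F :: "real \<Rightarrow> real \<Rightarrow> complex" and \<tau> :: "real \<Rightarrow> ennreal"
  assumes [measurable]: "\<And>R. F R \<in> borel_measurable borel"
    and cauchy: "\<And>R S. R \<le> S \<Longrightarrow> l2sq (\<lambda>x. F R x - F S x) \<le> \<tau> R"
    and \<tau>: "(\<tau> \<longlongrightarrow> 0) at_top"
  shows "\<exists>g \<in> borel_measurable borel. \<forall>R. l2sq (\<lambda>x. F R x - g x) \<le> \<tau> R"
proof -
  have "\<exists>N. \<forall>R\<ge>N. \<tau> R \<le> ennreal ((1 / 4) ^ n)" for n
  proof -
    have "0 < ennreal ((1 / 4) ^ n)" by simp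
    from order_tendstoD(2)[OF \<tau> this] show ?thesis
      unfolding eventually_at_top_linorder by (meson less_imp_le)
  qed
  then obtain \<rho> where \<rho>: "\<And>n R. \<rho> n \<le> R \<Longrightarrow> \<tau> R \<le> ennreal ((1 / 4) ^ n)" by metis
  \<comment> \<open>Summing makes \<open>r\<close> increasing, above every \<open>\<rho> n\<close>,
    and at least \<open>n\<close>, so that it tends to infinity.\<close>
  define r where "r n = (\<Sum>i\<le>n. \<bar>\<rho> i\<bar> + 1)" for n :: nat
  have r_Suc: "r n \<le> r (Suc n)" for n by (simp add: r_def)
  have r_ge: "\<rho> n \<le> r n" for n
  proof -
    have "\<bar>\<rho> n\<bar> + 1 \<le> r n" unfolding r_def by (rule member_le_sum) auto
    then show ?thesis by linarith
  qed
  have r_large: "real n \<le> r n" for n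
  proof -
    have "(\<Sum>i\<le>n. 1) \<le> r n" unfolding r_def by (rule sum_mono) simp
    then show ?thesis by simp
  qed
  \<comment> \<open>Along the rapidly convergent subsequence \<open>r\<close>, the sum of \<open>2^n \<bar>\<Delta> n x\<bar>\<^sup>2\<close> has finite integral, hence \<open>\<Delta> n x\<close> decays geometrically for almost every \<open>x\<close>.\<close>
  define \<Delta> where "\<Delta> n x = F (r n) x - F (r (Suc n)) x" for n x
  have [measurable]: "\<Delta> n \<in> borel_measurable borel" for n unfolding \<Delta>_def by measurable
  have \<Delta>: "l2sq (\<Delta> n) \<le> ennreal ((1 / 4) ^ n)" for n
    using cauchy[OF r_Suc[of n]] \<rho>[OF r_ge[of n]] unfolding \<Delta>_def by (rule order_trans)
  have "(\<integral>\<^sup>+ x. (\<Sum>n. ennreal (2 ^ n * (cmod (\<Delta> n x))\<^sup>2)) \<partial>lborel)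
      = (\<Sum>n. ennreal (2 ^ n) * l2sq (\<Delta> n))"
    unfolding l2sq_def by (simp add: nn_integral_suminf nn_integral_cmult ennreal_mult)
  also have "\<dots> \<le> (\<Sum>n. ennreal ((1 / 2) ^ n))"
  proof (intro suminf_le allI)
    fix n
    have "ennreal (2 ^ n) * l2sq (\<Delta> n) \<le> ennreal (2 ^ n) * ennreal ((1 / 4) ^ n)"
      by (rule mult_left_mono[OF \<Delta>]) simp
    also have "\<dots> = ennreal ((2 * (1 / 4)) ^ n)"
      unfolding power_mult_distrib by (rule ennreal_mult[symmetric]) simp_all
    finally show "ennreal (2 ^ n) * l2sq (\<Delta> n) \<le> ennreal ((1 / 2) ^ n)" by simp
  qed auto
  also have "\<dots> = ennreal (\<Sum>n. (1 / 2) ^ n)"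
    by (rule suminf_ennreal2) (auto intro: summable_geometric)
  also have "\<dots> < \<infinity>" by simp
  finally have fin: "(\<integral>\<^sup>+ x. (\<Sum>n. ennreal (2 ^ n * (cmod (\<Delta> n x))\<^sup>2)) \<partial>lborel) \<noteq> \<infinity>" by simp
  have "AE x in lborel. (\<Sum>n. ennreal (2 ^ n * (cmod (\<Delta> n x))\<^sup>2)) \<noteq> \<infinity>"
    by (rule nn_integral_PInf_AE[OF _ fin]) measurable
  then have conv: "AE x in lborel. convergent (\<lambda>n. F (r n) x)"
  proof (eventually_elim)
    fix x assume "(\<Sum>n. ennreal (2 ^ n * (cmod (\<Delta> n x))\<^sup>2)) \<noteq> \<infinity>"
    then obtain C where C: "0 \<le> C" "(\<Sum>n. ennreal (2 ^ n * (cmod (\<Delta> n x))\<^sup>2)) = ennreal C"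
      unfolding infinity_ennreal_def less_top less_top_ennreal by blast
    have le: "2 ^ n * (cmod (\<Delta> n x))\<^sup>2 \<le> C" for n
    proof -
      have "(\<Sum>n\<in>{n}. ennreal (2 ^ n * (cmod (\<Delta> n x))\<^sup>2)) \<le> (\<Sum>n. ennreal (2 ^ n * (cmod (\<Delta> n x))\<^sup>2))"
        by (rule sum_le_suminf[OF summableI]) simp_all
      then show ?thesis unfolding C(2) using C(1) by simp
    qed
    have "cmod (\<Delta> n x) \<le> sqrt C * (sqrt (1 / 2)) ^ n" for n
    proof -
      have "(cmod (\<Delta> n x))\<^sup>2 \<le> C * (1 / 2) ^ n" using le[of n] by (simp add: field_simps power_divide)
      then have "cmod (\<Delta> n x) \<le> sqrt (C * (1 / 2) ^ n)" by (rule real_le_rsqrt)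
      then show ?thesis by (simp add: real_sqrt_mult real_sqrt_power)
    qed
    moreover have "summable (\<lambda>n. sqrt C * (sqrt (1 / 2)) ^ n)"
    proof (intro summable_mult summable_geometric)
      have "sqrt (1 / 2) < sqrt 1" by (rule real_sqrt_less_mono) simp
      then show "norm (sqrt (1 / 2)) < 1" by simp
    qed
    ultimately have "summable (\<lambda>n. \<Delta> n x)"
      by (rule summable_comparison_test'[where N=0, rotated])
    then have "convergent (\<lambda>n. \<Sum>i<n. \<Delta> i x)" by (rule summable_iff_convergent[THEN iffD1])
    also have "(\<lambda>n. \<Sum>i<n. \<Delta> i x) = (\<lambda>n. F (r 0) x - F (r n) x)"
      unfolding \<Delta>_def by (rule ext) (rule sum_lessThan_telescope')
    finally show "convergent (\<lambda>n. F (r n) x)"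
      using convergent_diff[OF convergent_const[of "F (r 0) x"]] by fastforce
  qed
  \<comment> \<open>Where the sequence diverges, \<open>lim\<close> has an arbitrary value; this
    concerns a null set only.\<close>
  define g where "g x = lim (\<lambda>n. F (r n) x)" for x
  have g[measurable]: "g \<in> borel_measurable borel"
    unfolding g_def by (rule borel_measurable_lim_metric) simp
  \<comment> \<open>For fixed \<open>R\<close> the Cauchy bound applies as soon as
    \<open>R \<le> r n\<close>, hence for all large \<open>n\<close>.\<close>
  have "l2sq (\<lambda>x. F R x - g x) \<le> \<tau> R" for R
  proof -
    have "(\<integral>\<^sup>+ x. ennreal ((cmod (F R x - g x))\<^sup>2) \<partial>lborel) \<le> \<tau> R"
    proof (rule Fatou_bound[where f="\<lambda>n x. ennreal ((cmod (F R x - F (r n) x))\<^sup>2)"])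
      show "AE x in lborel. (\<lambda>n. ennreal ((cmod (F R x - F (r n) x))\<^sup>2)) \<longlonglongrightarrow> ennreal ((cmod (F R x - g x))\<^sup>2)"
        using conv unfolding g_def
        by eventually_elim (auto intro!: tendsto_intros simp: convergent_LIMSEQ_iff)
      have "R \<le> r n" if "nat \<lceil>R\<rceil> \<le> n" for n
        using r_large[of n] that by linarith
      then show "\<forall>\<^sub>F n in sequentially. (\<integral>\<^sup>+ x. ennreal ((cmod (F R x - F (r n) x))\<^sup>2) \<partial>lborel) \<le> \<tau> R"
        using cauchy[of R] unfolding l2sq_def eventually_sequentially by blast
    qed measurable
    then show ?thesis by (simp add: l2sq_def)
  qed
  with g show ?thesis by blast
qed

section \<open>Truncations, and existence of the transform as the limit of their transforms\<close>

lemma trunc_measurable [measurable]: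
  "f \<in> borel_measurable borel \<Longrightarrow> trunc R f \<in> borel_measurable borel"
  unfolding trunc_def by measurable

lemma square_integrable_trunc:
  assumes "square_integrable f"
  shows "square_integrable (trunc R f)"
  by (rule square_integrable_bound[OF assms])
    (use assms in \<open>auto simp: trunc_def indicator_def\<close>)

lemma integrable_trunc:
  assumes "square_integrable f"
  shows "integrable lborel (trunc R f)"
proof -
  have "l2sq (\<lambda>x. indicator {-R..R} x) = (\<integral>\<^sup>+ x. indicator {-R..R} x \<partial>lborel)"
    unfolding l2sq_def by (intro nn_integral_cong) (simp add: indicator_def)
  then have "l2sq (\<lambda>x. indicator {-R..R} x) < \<infinity>" by (simp add: emeasure_lborel_Icc_eq)
  then have "square_integrable (\<lambda>x. indicator {-R..R} x :: complex)"
    by (simp add: square_integrable_iff)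
  from integrable_mult_square_integrable[OF this assms] show ?thesis
    by (rule back_subst[of "integrable lborel"]) (auto simp: trunc_def indicator_def)
qed

lemma tendsto_trunc: "((\<lambda>R. trunc R f x) \<longlongrightarrow> f x) at_top"
proof (rule tendsto_eventually)
  show "\<forall>\<^sub>F R in at_top. trunc R f x = f x"
    using eventually_ge_at_top[of "\<bar>x\<bar>"] by eventually_elim (auto simp: trunc_def indicator_def)
qed

lemma tendsto_l2sq_trunc:
  assumes f: "square_integrable f"
  shows "((\<lambda>R. l2sq (\<lambda>x. trunc R f x - f x)) \<longlongrightarrow> 0) at_top"
proof -
  have [measurable]: "f \<in> borel_measurable borel" using f by auto
  have "((\<lambda>R. LINT x|lborel. (cmod (trunc R f x - f x))\<^sup>2) \<longlongrightarrow> (LINT x|lborel. (cmod (f x - f x))\<^sup>2)) at_top"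
  proof (rule integral_dominated_convergence_at_top)
    show "AE x in lborel. ((\<lambda>R. (cmod (trunc R f x - f x))\<^sup>2) \<longlongrightarrow> (cmod (f x - f x))\<^sup>2) at_top"
      by (intro AE_I2 tendsto_intros tendsto_trunc)
    show "integrable lborel (\<lambda>x. (cmod (f x))\<^sup>2)" using f by (simp add: square_integrable_def)
    show "\<forall>\<^sub>F R in at_top. AE x in lborel. norm ((cmod (trunc R f x - f x))\<^sup>2) \<le> (cmod (f x))\<^sup>2"
      by (intro always_eventually allI AE_I2) (simp add: trunc_def indicator_def)
  qed measurable
  then have "((\<lambda>R. ennreal (LINT x|lborel. (cmod (trunc R f x - f x))\<^sup>2)) \<longlongrightarrow> ennreal 0) at_top"
    by (intro tendsto_ennrealI) simp
  then show ?thesis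
    using f by (simp add: l2sq_eq square_integrable_diff square_integrable_trunc)
qed

lemma square_integrable_FT:
  assumes "integrable lborel f" "square_integrable f"
  shows "square_integrable (FT f)"
proof -
  have [measurable]: "f \<in> borel_measurable borel" using assms by auto
  have "ennreal (2 * pi) * l2sq f < \<infinity>"
    using assms by (auto simp: square_integrable_iff ennreal_mult_less_top)
  then show ?thesis
    using l2sq_FT_le[OF assms(1)] by (auto simp: square_integrable_iff)
qed

lemma has_fourier_iff:
  "has_fourier f g \<longleftrightarrow> square_integrable f \<and> square_integrable g \<and>
    ((\<lambda>R. l2sq (\<lambda>\<xi>. FT (trunc R f) \<xi> - g \<xi>)) \<longlongrightarrow> 0) at_top"
  unfolding has_fourier_def l2sq_def FT_def trunc_def set_lebesgue_integral_def
  by (simp add: mult_scaleR_right)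

text \<open>By the Bessel bound, the norm of the part of \<open>f\<close> outside
  \<open>[-R, R]\<close> controls how far the transforms of later truncations can move; completeness
  does the rest.\<close>

lemma has_fourier_exists:
  assumes f: "square_integrable f"
  shows "\<exists>g. has_fourier f g"
proof -
  have [measurable]: "f \<in> borel_measurable borel" using f by auto
  define \<tau> where "\<tau> R = ennreal (2 * pi) * l2sq (\<lambda>x. trunc R f x - f x)" for R
  have "(\<tau> \<longlongrightarrow> ennreal (2 * pi) * 0) at_top"
    unfolding \<tau>_def by (intro tendsto_mult_ennreal tendsto_l2sq_trunc f tendsto_const) auto
  then have \<tau>: "(\<tau> \<longlongrightarrow> 0) at_top" by simp
  have "\<exists>g \<in> borel_measurable borel. \<forall>R. l2sq (\<lambda>\<xi>. FT (trunc R f) \<xi> - g \<xi>) \<le> \<tau> R"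
  proof (rule L2_complete[OF _ _ \<tau>])
    fix R S :: real assume "R \<le> S"
    have "l2sq (\<lambda>\<xi>. FT (trunc R f) \<xi> - FT (trunc S f) \<xi>) = l2sq (FT (\<lambda>x. trunc R f x - trunc S f x))"
      by (simp add: FT_diff[OF integrable_trunc[OF f] integrable_trunc[OF f], abs_def])
    also have "\<dots> \<le> ennreal (2 * pi) * l2sq (\<lambda>x. trunc R f x - trunc S f x)"
      by (intro l2sq_FT_le Bochner_Integration.integrable_diff integrable_trunc f)
    \<comment> \<open>For \<open>R \<le> S\<close> the difference of the truncations is pointwise no
      larger than the discarded part \<open>trunc R f x - f x\<close>.\<close>
    also have "\<dots> \<le> \<tau> R"
      unfolding \<tau>_def l2sq_def using \<open>R \<le> S\<close>
      by (intro mult_left_mono nn_integral_mono) (auto simp: trunc_def indicator_def)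
    finally show "l2sq (\<lambda>\<xi>. FT (trunc R f) \<xi> - FT (trunc S f) \<xi>) \<le> \<tau> R" .
  qed measurable
  then obtain g where g[measurable]: "g \<in> borel_measurable borel"
    and le: "\<And>R. l2sq (\<lambda>\<xi>. FT (trunc R f) \<xi> - g \<xi>) \<le> \<tau> R" by blast
  have lim: "((\<lambda>R. l2sq (\<lambda>\<xi>. FT (trunc R f) \<xi> - g \<xi>)) \<longlongrightarrow> 0) at_top"
    by (rule tendsto_sandwich[OF _ _ tendsto_const \<tau>]) (auto intro!: always_eventually le)
  \<comment> \<open>Write \<open>g\<close> as a transform of a truncation minus a difference of
    finite norm; any radius would serve, and 0 is taken.\<close>
  have "\<tau> 0 < \<infinity>"
    using square_integrable_diff[OF square_integrable_trunc[OF f, of 0] f]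
    by (auto simp: \<tau>_def square_integrable_iff ennreal_mult_less_top)
  then have "l2sq (\<lambda>\<xi>. FT (trunc 0 f) \<xi> - g \<xi>) < \<infinity>" using le[of 0] by (rule order_le_less_trans[rotated])
  then have "square_integrable (\<lambda>\<xi>. FT (trunc 0 f) \<xi> - g \<xi>)"
    by (simp add: square_integrable_iff)
  from square_integrable_diff[OF square_integrable_FT[OF integrable_trunc[OF f] square_integrable_trunc[OF f], of 0] this]
  have "square_integrable g" by simp
  with f lim show ?thesis unfolding has_fourier_iff by blast
qed

text \<open>The transforms of the truncations converge to \<open>g\<close> in norm and, by dominated
  convergence, to \<open>FT f\<close> pointwise. Fatou shows that the distance between the two
  limits is 0.\<close>

lemma has_fourier_FT:
  assumes "has_fourier f g" "integrable lborel f"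
  shows "AE \<xi> in lborel. g \<xi> = FT f \<xi>"
proof -
  have f: "square_integrable f" and g: "square_integrable g"
    and lim: "((\<lambda>R. l2sq (\<lambda>\<xi>. FT (trunc R f) \<xi> - g \<xi>)) \<longlongrightarrow> 0) at_top"
    using assms(1) by (auto simp: has_fourier_iff)
  have [measurable]: "f \<in> borel_measurable borel" "g \<in> borel_measurable borel" using f g by auto
  have conv: "(\<lambda>n. FT (trunc (real n) f) \<xi>) \<longlonglongrightarrow> FT f \<xi>" for \<xi>
    unfolding FT_def
  proof (rule integral_dominated_convergence)
    show "integrable lborel (\<lambda>x. cmod (f x))" using assms(2) by simp
    show "AE x in lborel. (\<lambda>n. cis (- (x * \<xi>)) * trunc (real n) f x) \<longlonglongrightarrow> cis (- (x * \<xi>)) * f x"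
      by (intro AE_I2 tendsto_mult_left filterlim_compose[OF tendsto_trunc filterlim_real_sequentially])
  qed (auto simp: norm_mult trunc_def indicator_def)
  have lim': "(\<lambda>n. l2sq (\<lambda>\<xi>. FT (trunc (real n) f) \<xi> - g \<xi>)) \<longlonglongrightarrow> 0"
    by (rule filterlim_compose[OF lim filterlim_real_sequentially])
  have "(\<integral>\<^sup>+ \<xi>. ennreal ((cmod (FT f \<xi> - g \<xi>))\<^sup>2) \<partial>lborel) \<le> 0"
  proof (rule ennreal_le_epsilon)
    fix e :: real assume e: "0 < e"
    show "(\<integral>\<^sup>+ \<xi>. ennreal ((cmod (FT f \<xi> - g \<xi>))\<^sup>2) \<partial>lborel) \<le> 0 + ennreal e"
    proof (rule Fatou_bound[where f="\<lambda>n \<xi>. ennreal ((cmod (FT (trunc (real n) f) \<xi> - g \<xi>))\<^sup>2)"])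
      show "AE \<xi> in lborel. (\<lambda>n. ennreal ((cmod (FT (trunc (real n) f) \<xi> - g \<xi>))\<^sup>2)) \<longlonglongrightarrow> ennreal ((cmod (FT f \<xi> - g \<xi>))\<^sup>2)"
        by (intro AE_I2 tendsto_intros conv)
      have "\<forall>\<^sub>F n in sequentially. l2sq (\<lambda>\<xi>. FT (trunc (real n) f) \<xi> - g \<xi>) < ennreal e"
        using e by (intro order_tendstoD(2)[OF lim']) simp
      then show "\<forall>\<^sub>F n in sequentially. (\<integral>\<^sup>+ \<xi>. ennreal ((cmod (FT (trunc (real n) f) \<xi> - g \<xi>))\<^sup>2) \<partial>lborel) \<le> 0 + ennreal e"
        by eventually_elim (simp add: l2sq_def)
    qed measurable
  qed
  then have "(\<integral>\<^sup>+ \<xi>. ennreal ((cmod (FT f \<xi> - g \<xi>))\<^sup>2) \<partial>lborel) = 0" by simp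
  then have "AE \<xi> in lborel. ennreal ((cmod (FT f \<xi> - g \<xi>))\<^sup>2) = 0"
    by (subst (asm) nn_integral_0_iff_AE) auto
  then show ?thesis by eventually_elim simp
qed

text \<open>The exchange formula for integrable functions is extended by weak convergence: first the
  truncation of \<open>h\<close> is removed with that of \<open>f\<close> held fixed, then the
  truncation of \<open>f\<close>.\<close>

lemma has_fourier_exchange:
  assumes "has_fourier f g" "has_fourier h k"
  shows "(LINT \<xi>|lborel. g \<xi> * h \<xi>) = (LINT x|lborel. f x * k x)"
proof -
  have f: "square_integrable f" and g: "square_integrable g"
    and h: "square_integrable h" and k: "square_integrable k"
    and limf: "((\<lambda>R. l2sq (\<lambda>\<xi>. FT (trunc R f) \<xi> - g \<xi>)) \<longlongrightarrow> 0) at_top"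
    and limh: "((\<lambda>R. l2sq (\<lambda>\<xi>. FT (trunc R h) \<xi> - k \<xi>)) \<longlongrightarrow> 0) at_top"
    using assms by (auto simp: has_fourier_iff)
  note FTt = square_integrable_FT[OF integrable_trunc square_integrable_trunc]
  have "(LINT \<xi>|lborel. FT (trunc R f) \<xi> * h \<xi>) = (LINT x|lborel. trunc R f x * k x)" for R
  proof (rule tendsto_unique[OF trivial_limit_at_top_linorder])
    show "((\<lambda>S. LINT x|lborel. FT (trunc S h) x * trunc R f x) \<longlongrightarrow> (LINT x|lborel. trunc R f x * k x)) at_top"
      using tendsto_integral_l2sq[OF FTt[OF h h] k square_integrable_trunc[OF f] limh]
      by (simp add: mult.commute)
    have "(LINT x|lborel. FT (trunc S h) x * trunc R f x) = (LINT \<xi>|lborel. trunc S h \<xi> * FT (trunc R f) \<xi>)" for S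
      by (rule FT_exchange[OF integrable_trunc[OF h] integrable_trunc[OF f]])
    then show "((\<lambda>S. LINT x|lborel. FT (trunc S h) x * trunc R f x) \<longlongrightarrow> (LINT \<xi>|lborel. FT (trunc R f) \<xi> * h \<xi>)) at_top"
      using tendsto_integral_l2sq[OF square_integrable_trunc[OF h] h FTt[OF f f] tendsto_l2sq_trunc[OF h]]
      by (simp add: mult.commute)
  qed
  moreover have "((\<lambda>R. LINT \<xi>|lborel. FT (trunc R f) \<xi> * h \<xi>) \<longlongrightarrow> (LINT \<xi>|lborel. g \<xi> * h \<xi>)) at_top"
    by (rule tendsto_integral_l2sq[OF FTt[OF f f] g h limf])
  moreover have "((\<lambda>R. LINT x|lborel. trunc R f x * k x) \<longlongrightarrow> (LINT x|lborel. f x * k x)) at_top"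
    by (rule tendsto_integral_l2sq[OF square_integrable_trunc[OF f] f k tendsto_l2sq_trunc[OF f]])
  ultimately show ?thesis
    by (simp add: tendsto_unique[OF trivial_limit_at_top_linorder])
qed

section \<open>The inverse transform and Parseval's identity\<close>

lemma square_integrable_reflect:
  assumes "square_integrable f"
  shows "square_integrable (\<lambda>x. f (- x))"
proof -
  have [measurable]: "f \<in> borel_measurable borel" using assms by auto
  have "l2sq (\<lambda>x. f (- x)) = l2sq f"
    unfolding l2sq_def by (subst (2) nn_integral_real_affine[where c="-1" and t=0]) auto
  then show ?thesis using assms by (auto simp: square_integrable_iff)
qed

text \<open>Changing the sign of the phase is a reflection, and the prefactor is
  \<open>1 / (2 * pi)\<close>; hence facts about the inverse transform reduce to facts about the
  forward one.\<close>

lemma has_inv_fourier_iff: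
  "has_inv_fourier h u \<longleftrightarrow> has_fourier h (\<lambda>x. of_real (2 * pi) * u (- x))"
proof (cases "square_integrable h \<and> square_integrable u")
  \<comment> \<open>Reflection and scaling preserve square integrability, so here both sides are
    false.\<close>
  case False
  have "\<not> square_integrable (\<lambda>x. of_real (2 * pi) * u (- x))" if "\<not> square_integrable u"
  proof
    assume "square_integrable (\<lambda>x. of_real (2 * pi) * u (- x))"
    from square_integrable_reflect[OF square_integrable_cmult[OF this, of "1 / of_real (2 * pi)"]]
    show False using that by simp
  qed
  with False show ?thesis by (auto simp: has_inv_fourier_def has_fourier_def)
next
  case True
  then have [measurable]: "h \<in> borel_measurable borel" "u \<in> borel_measurable borel" by auto
  define K where "K R = (\<integral>\<^sup>+ x. ennreal ((cmod (1 / (2 * of_real pi) *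
      (LINT \<xi>:{-R..R}|lborel. cis (x * \<xi>) * h \<xi>) - u x))\<^sup>2) \<partial>lborel)" for R
  define L where "L R = l2sq (\<lambda>x. FT (trunc R h) x - of_real (2 * pi) * u (- x))" for R
  have L: "L R = ennreal ((2 * pi)\<^sup>2) * K R" for R
  proof -
    have "(LINT \<xi>:{-R..R}|lborel. cis (x * \<xi>) * h \<xi>) = FT (trunc R h) (- x)" for x
      unfolding FT_def trunc_def set_lebesgue_integral_def by (simp add: mult_scaleR_right mult.commute)
    then have "K R = (\<integral>\<^sup>+ x. ennreal ((cmod (1 / (2 * of_real pi) * FT (trunc R h) (- x) - u x))\<^sup>2) \<partial>lborel)"
      unfolding K_def by simp
    also have "\<dots> = (\<integral>\<^sup>+ x. ennreal ((cmod (1 / (2 * of_real pi) * FT (trunc R h) x - u (- x)))\<^sup>2) \<partial>lborel)"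
      by (subst nn_integral_real_affine[where c="-1" and t=0]) auto
    finally have "ennreal ((2 * pi)\<^sup>2) * K R = (\<integral>\<^sup>+ x. ennreal ((2 * pi)\<^sup>2) *
        ennreal ((cmod (1 / (2 * of_real pi) * FT (trunc R h) x - u (- x)))\<^sup>2) \<partial>lborel)"
      by (subst nn_integral_cmult) auto
    also have "\<dots> = L R"
      unfolding L_def l2sq_def
    proof (rule nn_integral_cong)
      fix x
      have "FT (trunc R h) x - of_real (2 * pi) * u (- x)
          = of_real (2 * pi) * (1 / (2 * of_real pi) * FT (trunc R h) x - u (- x))"
        by (simp add: field_simps)
      then have "cmod (FT (trunc R h) x - of_real (2 * pi) * u (- x)) = (2 * pi) * cmod (1 / (2 * of_real pi) * FT (trunc R h) x - u (- x))"
        by (simp only: norm_mult) simp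
      then show "ennreal ((2 * pi)\<^sup>2) * ennreal ((cmod (1 / (2 * of_real pi) * FT (trunc R h) x - u (- x)))\<^sup>2)
          = ennreal ((cmod (FT (trunc R h) x - of_real (2 * pi) * u (- x)))\<^sup>2)"
        by (simp add: power_mult_distrib flip: ennreal_mult)
    qed
    finally show ?thesis by simp
  qed
  have K: "K R = ennreal (1 / (2 * pi)\<^sup>2) * L R" for R
    unfolding L by (simp flip: ennreal_mult mult.assoc)
  have "(K \<longlongrightarrow> 0) at_top \<longleftrightarrow> (L \<longlongrightarrow> 0) at_top"
  proof
    assume "(K \<longlongrightarrow> 0) at_top"
    then have "((\<lambda>R. ennreal ((2 * pi)\<^sup>2) * K R) \<longlongrightarrow> ennreal ((2 * pi)\<^sup>2) * 0) at_top"
      by (intro tendsto_mult_ennreal tendsto_const) auto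
    then show "(L \<longlongrightarrow> 0) at_top" by (simp only: L[symmetric] mult_zero_right)
  next
    assume "(L \<longlongrightarrow> 0) at_top"
    then have "((\<lambda>R. ennreal (1 / (2 * pi)\<^sup>2) * L R) \<longlongrightarrow> ennreal (1 / (2 * pi)\<^sup>2) * 0) at_top"
      by (intro tendsto_mult_ennreal tendsto_const) auto
    then show "(K \<longlongrightarrow> 0) at_top" by (simp only: K[symmetric] mult_zero_right)
  qed
  with True square_integrable_cmult[OF square_integrable_reflect]
  show ?thesis unfolding has_inv_fourier_def has_fourier_iff K_def L_def by auto
qed

lemma has_inv_fourier_exists:
  assumes "square_integrable h"
  shows "\<exists>u. has_inv_fourier h u"
proof -
  obtain k where "has_fourier h k" using has_fourier_exists[OF assms] by blast
  then have "has_inv_fourier h (\<lambda>x. k (- x) / of_real (2 * pi))" by (simp add: has_inv_fourier_iff)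
  then show ?thesis by blast
qed

lemma has_inv_fourier_FT:
  assumes "has_inv_fourier h u" "integrable lborel h"
  shows "AE x in lborel. u x = FT h (- x) / of_real (2 * pi)"
proof -
  have [measurable]: "h \<in> borel_measurable borel" "u \<in> borel_measurable borel"
    using assms by (auto simp: has_inv_fourier_def)
  have "AE x in lborel. of_real (2 * pi) * u (- x) = FT h x"
    using assms by (intro has_fourier_FT) (auto simp: has_inv_fourier_iff)
  then have "AE x in lborel. of_real (2 * pi) * u (- (0 + (-1) * x)) = FT h (0 + (-1) * x)"
    by (rule AE_borel_affine[rotated 2]) auto
  then show ?thesis by eventually_elim (simp add: field_simps)
qed

text \<open>Conjugation alone would also reflect the transform; reflecting the argument as well
  leaves a plain conjugate, as Parseval's identity requires.\<close>

lemma has_fourier_cnj_reflect: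
  assumes "has_fourier v g"
  shows "has_fourier (\<lambda>x. cnj (v (- x))) (\<lambda>\<xi>. cnj (g \<xi>))"
proof -
  have cnj: "square_integrable (\<lambda>x. cnj (f x))" if "square_integrable f" for f
    by (rule square_integrable_bound[OF that]) (use that in auto)
  have "FT (trunc R (\<lambda>x. cnj (v (- x)))) \<xi> = cnj (FT (trunc R v) \<xi>)" for R \<xi>
  proof -
    have "trunc R (\<lambda>x. cnj (v (- x))) = (\<lambda>x. cnj (trunc R v (- x)))"
      by (auto simp: trunc_def indicator_def fun_eq_iff)
    then show ?thesis
      using FT_cnj[of "trunc R v" \<xi>] FT_reflect[of "\<lambda>x. cnj (trunc R v x)" \<xi>] by simp
  qed
  moreover have "l2sq (\<lambda>\<xi>. cnj (a \<xi>) - cnj (b \<xi>)) = l2sq (\<lambda>\<xi>. a \<xi> - b \<xi>)" for a b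
    unfolding l2sq_def by (simp flip: complex_cnj_diff)
  ultimately show ?thesis
    using assms by (auto simp: has_fourier_iff intro!: cnj square_integrable_reflect[of v])
qed

text \<open>Apply the exchange formula to the conjugated reflection of \<open>v\<close> and to
  \<open>h\<close>, whose forward transform is a reflected multiple of \<open>u\<close>. The two
  reflections cancel under the substitution of \<open>- x\<close> for \<open>x\<close>.\<close>

lemma Parseval:
  assumes "has_fourier v g" "has_inv_fourier h u"
  shows "(LINT x|lborel. u x * cnj (v x)) = (LINT \<xi>|lborel. h \<xi> * cnj (g \<xi>)) / of_real (2 * pi)"
proof -
  have "(LINT \<xi>|lborel. cnj (g \<xi>) * h \<xi>) = (LINT x|lborel. cnj (v (- x)) * (of_real (2 * pi) * u (- x)))"
    using assms(2) by (intro has_fourier_exchange has_fourier_cnj_reflect assms(1)) (simp add: has_inv_fourier_iff)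
  also have "\<dots> = (LINT x|lborel. of_real (2 * pi) * (u x * cnj (v x)))"
    by (subst lborel_integral_real_affine[where c="-1" and t=0]) (simp_all add: mult_ac)
  also have "\<dots> = of_real (2 * pi) * (LINT x|lborel. u x * cnj (v x))"
    by (rule integral_mult_right_zero)
  finally show ?thesis by (simp add: mult.commute)
qed

subsection \<open>Fourier inversion\<close>

text \<open>The positive and negative parts of \<open>f\<close> are densities of two finite measures
  that agree on all rays \<open>{x<..}\<close>, hence are equal; densities are unique almost
  everywhere.\<close>

lemma AE_zero_if_tail_integrals_zero:
  fixes f :: "real \<Rightarrow> real"
  assumes f: "integrable lborel f"
    and zero: "\<And>x. (LINT y:{x<..}|lborel. f y) = 0"
  shows "AE x in lborel. f x = 0"
proof -
  have [measurable]: "f \<in> borel_measurable borel" using f by auto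
  have em: "emeasure (density lborel (\<lambda>y. ennreal (k y))) {x<..} = ennreal (LINT y:{x<..}|lborel. max 0 (k y))"
    if k: "integrable lborel k" for k :: "real \<Rightarrow> real" and x
  proof -
    have [measurable]: "k \<in> borel_measurable borel" using k by auto
    have "emeasure (density lborel (\<lambda>y. ennreal (k y))) {x<..} = (\<integral>\<^sup>+ y. ennreal (indicator {x<..} y * max 0 (k y)) \<partial>lborel)"
      by (subst emeasure_density) (auto intro!: nn_integral_cong simp: indicator_def max_def ennreal_neg)
    also have "\<dots> = ennreal (LINT y:{x<..}|lborel. max 0 (k y))"
      unfolding set_lebesgue_integral_def real_scaleR_def using k
      by (intro nn_integral_eq_integral integrable_mult_indicator[where 'b=real, unfolded real_scaleR_def] integrable_max) auto
    finally show ?thesis .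
  qed
  have "density lborel (\<lambda>y. ennreal (f y)) = density lborel (\<lambda>y. ennreal (- f y))"
  proof (rule measure_eqI_lessThan)
    fix x
    have si: "set_integrable lborel {x<..} k" if "integrable lborel k" for k :: "real \<Rightarrow> real"
      unfolding set_integrable_def by (rule integrable_mult_indicator) (use that in auto)
    have "(LINT y:{x<..}|lborel. max 0 (f y)) - (LINT y:{x<..}|lborel. max 0 (- f y)) = (LINT y:{x<..}|lborel. max 0 (f y) - max 0 (- f y))"
      using f by (intro set_integral_diff(2)[symmetric] si integrable_max) auto
    also have "\<dots> = (LINT y:{x<..}|lborel. f y)"
      by (intro set_lebesgue_integral_cong) (auto simp: max_def)
    finally have "(LINT y:{x<..}|lborel. max 0 (f y)) = (LINT y:{x<..}|lborel. max 0 (- f y))" using zero by simp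
    then show "emeasure (density lborel (\<lambda>y. ennreal (f y))) {x<..} = emeasure (density lborel (\<lambda>y. ennreal (- f y))) {x<..}"
      using em[OF f] em[of "\<lambda>y. - f y"] f by simp
    show "emeasure (density lborel (\<lambda>y. ennreal (f y))) {x<..} < \<infinity>" using em[OF f] by simp
  qed auto
  \<comment> \<open>Since \<open>ennreal\<close> sends negative numbers to 0, this equates the
    positive and negative parts, at least one of which is 0 at every point.\<close>
  then have "AE x in lborel. ennreal (f x) = ennreal (- f x)"
    by (subst (asm) sigma_finite_measure.density_unique_iff[OF sigma_finite_lborel]) auto
  then show ?thesis
    by eventually_elim (metis ennreal_eq_0_iff ennreal_neg le_cases neg_0_le_iff_le neg_le_0_iff_le order_antisym)
qed

text \<open>Away from the endpoints the indicator is locally constant, so the integrand is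
  eventually constant in \<open>n\<close> for each \<open>z\<close>; the density dominates.\<close>

lemma gaussian_average_indicator:
  fixes a b x :: real
  assumes "x \<noteq> a" "x \<noteq> b"
  shows "(\<lambda>n. LINT z|lborel. complex_of_real (std_normal_density z) * of_real (indicator {a<..b} (x - 1 / Suc n * z)))
    \<longlonglongrightarrow> of_real (indicator {a<..b} x)"
proof -
  have "(\<lambda>n. LINT z|lborel. complex_of_real (std_normal_density z) * of_real (indicator {a<..b} (x - 1 / Suc n * z)))
    \<longlonglongrightarrow> (LINT z|lborel. complex_of_real (std_normal_density z) * of_real (indicator {a<..b} x))"
  proof (rule integral_dominated_convergence)
    show "integrable lborel std_normal_density" by simp
    show "AE z in lborel. (\<lambda>n. complex_of_real (std_normal_density z) * of_real (indicator {a<..b} (x - 1 / Suc n * z)))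
       \<longlonglongrightarrow> complex_of_real (std_normal_density z) * of_real (indicator {a<..b} x)"
    proof (intro AE_I2 tendsto_intros)
      fix z
      have lim: "(\<lambda>n. x - 1 / Suc n * z) \<longlonglongrightarrow> x - 0 * z"
        by (intro tendsto_intros LIMSEQ_inverse_real_of_nat[unfolded inverse_eq_divide])
      then have lim: "(\<lambda>n. x - 1 / Suc n * z) \<longlonglongrightarrow> x" by simp
      have "\<forall>\<^sub>F n in sequentially. indicator {a<..b} (x - 1 / Suc n * z) = (indicator {a<..b} x :: real)"
      proof -
        consider "x < a" | "a < x" "x < b" | "b < x" using assms by linarith
        then show ?thesis
        proof cases
          case 1
          from order_tendstoD(2)[OF lim 1] show ?thesis by eventually_elim (use 1 in simp)
        next
          case 2
          from order_tendstoD(1)[OF lim 2(1)] order_tendstoD(2)[OF lim 2(2)] show ?thesis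
            by eventually_elim (use 2 in simp)
        next
          case 3
          from order_tendstoD(1)[OF lim 3] show ?thesis by eventually_elim (use 3 in simp)
        qed
      qed
      then show "(\<lambda>n. indicator {a<..b} (x - 1 / Suc n * z) :: real) \<longlonglongrightarrow> indicator {a<..b} x"
        by (rule tendsto_eventually)
    qed
  qed (auto simp: norm_mult indicator_def)
  then show ?thesis by simp
qed

section \<open>Pairings with indicators of intervals, and the inversion formula\<close>

lemma emeasure_lborel_Ioc_finite: "emeasure lborel {a<..b::real} < \<infinity>"
  by (cases "a \<le> b") auto

lemma integrable_indicator_Ioc:
  fixes a b :: real
  shows "integrable lborel (\<lambda>x. complex_of_real (indicator {a<..b} x))"
  unfolding complex_of_real_integrable_eq
  by (intro integrable_real_indicator emeasure_lborel_Ioc_finite) simp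

lemma square_integrable_indicator_Ioc:
  fixes a b :: real
  shows "square_integrable (\<lambda>x. complex_of_real (indicator {a<..b} x))"
proof -
  have "l2sq (\<lambda>x. complex_of_real (indicator {a<..b} x)) = (\<integral>\<^sup>+ x. indicator {a<..b} x \<partial>lborel)"
    unfolding l2sq_def by (intro nn_integral_cong) (simp add: indicator_def)
  then show ?thesis
    using emeasure_lborel_Ioc_finite[of a b] by (auto simp: square_integrable_iff)
qed

text \<open>Both sides of the regularised pairing pass to the limit by dominated convergence. On the
  frequency side the bound is a product of two square-integrable transforms; on the space side it is
  \<open>cmod (f x)\<close>, and the two endpoints are negligible.\<close>

lemma FT_pairing_indicator:
  fixes f :: "real \<Rightarrow> complex"
  assumes f: "integrable lborel f" "square_integrable f"
  shows "(LINT \<xi>|lborel. FT f \<xi> * FT (\<lambda>x. of_real (indicator {a<..b} x)) (- \<xi>))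
    = of_real (2 * pi) * (LINT x|lborel. f x * of_real (indicator {a<..b} x))"
proof -
  let ?\<phi> = "\<lambda>x. complex_of_real (indicator {a<..b} x)"
  let ?\<gamma> = "\<lambda>n \<xi>. exp (- (1 / Suc n * \<xi>)\<^sup>2 / 2) :: real"
  have [measurable]: "f \<in> borel_measurable borel" using f by auto
  note \<phi> = integrable_indicator_Ioc[of a b] and \<phi>2 = square_integrable_indicator_Ioc[of a b]
  have \<phi>r: "integrable lborel (\<lambda>x. ?\<phi> (- x))"
    using lborel_integrable_real_affine[OF \<phi>, of "-1" 0] by simp
  have i: "integrable lborel (\<lambda>\<xi>. FT f \<xi> * FT ?\<phi> (- \<xi>))"
    unfolding FT_reflect
    by (intro integrable_mult_square_integrable square_integrable_FT f \<phi>r square_integrable_reflect[OF \<phi>2])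
  have "(\<lambda>n. LINT \<xi>|lborel. of_real (?\<gamma> n \<xi>) * FT f \<xi> * FT ?\<phi> (- \<xi>)) \<longlonglongrightarrow> (LINT \<xi>|lborel. FT f \<xi> * FT ?\<phi> (- \<xi>))"
  proof (rule integral_dominated_convergence)
    show "integrable lborel (\<lambda>\<xi>. cmod (FT f \<xi> * FT ?\<phi> (- \<xi>)))" using i by (rule integrable_norm)
    have "(\<lambda>n. complex_of_real (?\<gamma> n \<xi>)) \<longlonglongrightarrow> of_real (exp (- (0 * \<xi>)\<^sup>2 / 2))" for \<xi>
      by (intro tendsto_intros LIMSEQ_inverse_real_of_nat[unfolded inverse_eq_divide]) auto
    then have "(\<lambda>n. complex_of_real (?\<gamma> n \<xi>) * (FT f \<xi> * FT ?\<phi> (- \<xi>))) \<longlonglongrightarrow> of_real (exp (- (0 * \<xi>)\<^sup>2 / 2)) * (FT f \<xi> * FT ?\<phi> (- \<xi>))" for \<xi>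
      by (rule tendsto_mult_right)
    then show "AE \<xi> in lborel. (\<lambda>n. complex_of_real (?\<gamma> n \<xi>) * FT f \<xi> * FT ?\<phi> (- \<xi>)) \<longlonglongrightarrow> FT f \<xi> * FT ?\<phi> (- \<xi>)"
      by (simp add: mult.assoc)
    show "AE \<xi> in lborel. cmod (complex_of_real (?\<gamma> n \<xi>) * FT f \<xi> * FT ?\<phi> (- \<xi>)) \<le> cmod (FT f \<xi> * FT ?\<phi> (- \<xi>))" for n
      by (intro AE_I2) (auto simp: norm_mult intro!: mult_right_mono mult_left_le_one_le)
  qed measurable
  moreover have "(LINT \<xi>|lborel. of_real (?\<gamma> n \<xi>) * FT f \<xi> * FT ?\<phi> (- \<xi>)) =
      of_real (2 * pi) * (LINT x|lborel. f x * (LINT z|lborel. of_real (std_normal_density z) * ?\<phi> (x - 1 / Suc n * z)))" for n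
    by (rule gaussian_regularised_pairing[OF _ f(1) \<phi>]) simp
  ultimately have 1: "(\<lambda>n. of_real (2 * pi) * (LINT x|lborel. f x * (LINT z|lborel. of_real (std_normal_density z) * ?\<phi> (x - 1 / Suc n * z))))
      \<longlonglongrightarrow> (LINT \<xi>|lborel. FT f \<xi> * FT ?\<phi> (- \<xi>))" by simp
  have "(\<lambda>n. LINT x|lborel. f x * (LINT z|lborel. of_real (std_normal_density z) * ?\<phi> (x - 1 / Suc n * z)))
      \<longlonglongrightarrow> (LINT x|lborel. f x * ?\<phi> x)"
  proof (rule integral_dominated_convergence)
    show "integrable lborel (\<lambda>x. cmod (f x))" using f by simp
    have "AE x in lborel. x \<noteq> a \<and> x \<noteq> b" using AE_lborel_singleton[of a] AE_lborel_singleton[of b] by eventually_elim simp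
    then show "AE x in lborel. (\<lambda>n. f x * (LINT z|lborel. of_real (std_normal_density z) * ?\<phi> (x - 1 / Suc n * z))) \<longlonglongrightarrow> f x * ?\<phi> x"
      by eventually_elim (intro tendsto_mult_left gaussian_average_indicator, auto)
    show "AE x in lborel. cmod (f x * (LINT z|lborel. of_real (std_normal_density z) * ?\<phi> (x - 1 / Suc n * z))) \<le> cmod (f x)" for n
    proof (rule AE_I2)
      fix x
      have "cmod (LINT z|lborel. of_real (std_normal_density z) * ?\<phi> (x - 1 / Suc n * z)) \<le> (LINT z|lborel. std_normal_density z)"
        by (rule order_trans[OF integral_norm_bound integral_mono']) (auto simp: norm_mult indicator_def)
      then show "cmod (f x * (LINT z|lborel. of_real (std_normal_density z) * ?\<phi> (x - 1 / Suc n * z))) \<le> cmod (f x)"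
        by (simp add: norm_mult mult_left_le)
    qed
  qed measurable
  then have 2: "(\<lambda>n. of_real (2 * pi) * (LINT x|lborel. f x * (LINT z|lborel. of_real (std_normal_density z) * ?\<phi> (x - 1 / Suc n * z))))
      \<longlonglongrightarrow> of_real (2 * pi) * (LINT x|lborel. f x * ?\<phi> x)"
    by (rule tendsto_mult_left)
  show ?thesis by (rule LIMSEQ_unique[OF 1 2])
qed

text \<open>Truncate \<open>f\<close> and use weak convergence on both sides; this removes the
  integrability of \<open>f\<close> from the previous identity.\<close>

lemma has_fourier_pairing_indicator:
  assumes "has_fourier f g"
  shows "(LINT \<xi>|lborel. g \<xi> * FT (\<lambda>x. of_real (indicator {a<..b} x)) (- \<xi>))
    = of_real (2 * pi) * (LINT x|lborel. f x * of_real (indicator {a<..b} x))"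
proof -
  let ?\<phi> = "\<lambda>x. complex_of_real (indicator {a<..b} x)"
  note \<phi> = integrable_indicator_Ioc[of a b] and \<phi>2 = square_integrable_indicator_Ioc[of a b]
  have \<phi>r: "integrable lborel (\<lambda>x. ?\<phi> (- x))"
    using lborel_integrable_real_affine[OF \<phi>, of "-1" 0] by simp
  have \<psi>: "square_integrable (\<lambda>\<xi>. FT ?\<phi> (- \<xi>))"
    unfolding FT_reflect by (intro square_integrable_FT \<phi>r square_integrable_reflect[OF \<phi>2])
  have f: "square_integrable f" and g: "square_integrable g"
    and lim: "((\<lambda>R. l2sq (\<lambda>\<xi>. FT (trunc R f) \<xi> - g \<xi>)) \<longlongrightarrow> 0) at_top"
    using assms by (auto simp: has_fourier_iff)
  have 1: "((\<lambda>R. LINT \<xi>|lborel. FT (trunc R f) \<xi> * FT ?\<phi> (- \<xi>)) \<longlongrightarrow> (LINT \<xi>|lborel. g \<xi> * FT ?\<phi> (- \<xi>))) at_top"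
    by (intro tendsto_integral_l2sq square_integrable_FT integrable_trunc square_integrable_trunc f g \<psi> lim)
  have "((\<lambda>R. LINT x|lborel. trunc R f x * ?\<phi> x) \<longlongrightarrow> (LINT x|lborel. f x * ?\<phi> x)) at_top"
    by (intro tendsto_integral_l2sq square_integrable_trunc f \<phi>2 tendsto_l2sq_trunc)
  then have 2: "((\<lambda>R. of_real (2 * pi) * (LINT x|lborel. trunc R f x * ?\<phi> x)) \<longlongrightarrow> of_real (2 * pi) * (LINT x|lborel. f x * ?\<phi> x)) at_top"
    by (rule tendsto_mult_left)
  show ?thesis
    using tendsto_unique[OF trivial_limit_at_top_linorder 1] 2
    by (simp add: FT_pairing_indicator[OF integrable_trunc[OF f] square_integrable_trunc[OF f]])
qed

text \<open>By the exchange formula and the pairing with indicators, \<open>f\<close> and the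
  inverse integral of \<open>g\<close> have the same integral over every bounded interval, which
  forces equality almost everywhere.\<close>

lemma Fourier_inversion:
  assumes "has_fourier f g" and g: "integrable lborel g"
  shows "AE x in lborel. f x = FT g (- x) / of_real (2 * pi)"
proof -
  define d where "d x = f x - FT g (- x) / of_real (2 * pi)" for x
  have f: "square_integrable f" using assms by (simp add: has_fourier_def)
  have [measurable]: "f \<in> borel_measurable borel" "g \<in> borel_measurable borel" using f g by auto
  note \<phi> = integrable_indicator_Ioc and \<phi>2 = square_integrable_indicator_Ioc
  have fi: "integrable lborel (\<lambda>x. f x * of_real (indicator {a<..b} x))" for a b
    by (rule integrable_mult_square_integrable[OF f \<phi>2])
  have ig: "integrable lborel (\<lambda>x. FT g (- x) / of_real (2 * pi) * of_real (indicator {a<..b} x))" for a b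
    by (rule integrable_bounded_mult[OF \<phi>, where B="(LINT x|lborel. norm (g x)) / (2 * pi)"])
      (auto simp: norm_divide intro!: divide_right_mono norm_FT_le)
  have id: "integrable lborel (\<lambda>x. d x * of_real (indicator {a<..b} x))" for a b
    using Bochner_Integration.integrable_diff[OF fi ig, of a b a b]
    by (simp add: d_def left_diff_distrib)
  have zero: "(LINT x|lborel. d x * of_real (indicator {a<..b} x)) = 0" for a b
  proof -
    let ?\<phi> = "\<lambda>x. complex_of_real (indicator {a<..b} x)"
    have \<phi>r: "integrable lborel (\<lambda>x. ?\<phi> (- x))"
      using lborel_integrable_real_affine[OF \<phi>[of a b], of "-1" 0] by simp
    have "(LINT x|lborel. FT g (- x) / of_real (2 * pi) * ?\<phi> x) = (LINT x|lborel. FT g x * ?\<phi> (- x)) / of_real (2 * pi)"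
      by (subst lborel_integral_real_affine[where c="-1" and t=0]) simp_all
    also have "(LINT x|lborel. FT g x * ?\<phi> (- x)) = (LINT \<xi>|lborel. g \<xi> * FT ?\<phi> (- \<xi>))"
      unfolding FT_reflect by (rule FT_exchange[OF g \<phi>r])
    also have "\<dots> = of_real (2 * pi) * (LINT x|lborel. f x * ?\<phi> x)"
      by (rule has_fourier_pairing_indicator[OF assms(1)])
    finally have "(LINT x|lborel. FT g (- x) / of_real (2 * pi) * ?\<phi> x) = (LINT x|lborel. f x * ?\<phi> x)" by simp
    then show ?thesis
      using fi ig by (simp add: d_def left_diff_distrib)
  qed
  \<comment> \<open>The tail-integral criterion is for real integrable functions, so
    \<open>d\<close> is split into real and imaginary parts and cut off to a bounded
    interval.\<close>
  have part: "AE x in lborel. indicator {- real n<..real n} x * P (d x) = 0"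
    if P: "P = Re \<or> P = Im" for P n
  proof (rule AE_zero_if_tail_integrals_zero)
    have ind: "P (d x * of_real r) = r * P (d x)" for x r using P by auto
    have bl: "bounded_linear P" using P by (auto intro: bounded_linear_Re bounded_linear_Im)
    show "integrable lborel (\<lambda>x. indicator {- real n<..real n} x * P (d x))"
      using integrable_bounded_linear[OF bl id] by (simp add: ind)
    fix x
    \<comment> \<open>A ray meets \<open>{- n<..n}\<close> in another half-open interval, over which
      the integral of \<open>d\<close> vanishes.\<close>
    have "(LINT y:{x<..}|lborel. indicator {- real n<..real n} y * P (d y))
      = (LINT y|lborel. P (d y * of_real (indicator {max x (- real n)<..real n} y)))"
      unfolding set_lebesgue_integral_def ind
      by (intro Bochner_Integration.integral_cong) (auto simp: indicator_def)
    also have "\<dots> = 0"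
      by (subst integral_bounded_linear[OF bl id]) (use P in \<open>auto simp: zero\<close>)
    finally show "(LINT y:{x<..}|lborel. indicator {- real n<..real n} y * P (d y)) = 0" .
  qed
  have "AE x in lborel. \<forall>n. indicator {- real n<..real n} x * Re (d x) = 0 \<and> indicator {- real n<..real n} x * Im (d x) = 0"
    unfolding AE_all_countable
  proof
    fix n show "AE x in lborel. indicator {- real n<..real n} x * Re (d x) = 0 \<and> indicator {- real n<..real n} x * Im (d x) = 0"
      using part[of Re n] part[of Im n] by auto
  qed
  then show ?thesis
  proof eventually_elim
    fix x assume *: "\<forall>n. indicator {- real n<..real n} x * Re (d x) = 0 \<and> indicator {- real n<..real n} x * Im (d x) = 0"
    obtain n where "\<bar>x\<bar> < real n" using reals_Archimedean2 by blast
    then have "indicator {- real n<..real n} x = (1 :: real)" by (auto simp: indicator_def)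
    then have "d x = 0" using *[rule_format, of n] by (simp add: complex_eq_iff)
    then show "f x = FT g (- x) / of_real (2 * pi)" by (simp add: d_def)
  qed
qed

subsection \<open>Positivity\<close>

lemma one_minus_cos_le: "1 - cos y \<le> y\<^sup>2 / 2" for y :: real
proof -
  have "1 - cos y = 2 * (sin (y / 2))\<^sup>2" using cos_double_sin[of "y / 2"] by simp
  also have "(sin (y / 2))\<^sup>2 \<le> (y / 2)\<^sup>2"
    using abs_sin_x_le_abs_x[of "y / 2"] by (simp only: abs_le_square_iff)
  finally show ?thesis by (simp add: power_divide)
qed

text \<open>Near 0 the factor \<open>1 - cos t\<close> is at most \<open>t\<^sup>2\<close>, which
  leaves the exponent \<open>1 - \<alpha> > -1\<close>; beyond 1 it is at most 2, and the exponent
  \<open>- 1 - \<alpha>\<close> is below -1.\<close>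

lemma nn_integral_powr_cosine_finite:
  fixes \<alpha> :: real
  assumes "0 < \<alpha>" "\<alpha> < 2"
  shows "(\<integral>\<^sup>+ t. ennreal (indicator {0<..} t * (t powr (- 1 - \<alpha>) * (1 - cos t))) \<partial>lborel) < \<infinity>"
proof -
  have 1: "(\<integral>\<^sup>+ t. ennreal (if t \<in> {0..1} then t powr (1 - \<alpha>) else 0) \<partial>lborel) = ennreal (1 powr (1 - \<alpha> + 1) / (1 - \<alpha> + 1))"
    by (intro nn_integral_has_integral_lborel has_integral_restrict_UNIV[THEN iffD2] has_integral_powr_from_0)
      (use assms in auto)
  have 2: "(\<integral>\<^sup>+ t. ennreal (if t \<in> {1..} then t powr (- 1 - \<alpha>) else 0) \<partial>lborel) = ennreal (- (1 powr (- 1 - \<alpha> + 1)) / (- 1 - \<alpha> + 1))"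
    by (intro nn_integral_has_integral_lborel has_integral_restrict_UNIV[THEN iffD2] has_integral_powr_to_inf)
      (use assms in auto)
  have "(\<integral>\<^sup>+ t. ennreal (indicator {0<..} t * (t powr (- 1 - \<alpha>) * (1 - cos t))) \<partial>lborel)
     \<le> (\<integral>\<^sup>+ t. ennreal (if t \<in> {0..1} then t powr (1 - \<alpha>) else 0) + 2 * ennreal (if t \<in> {1..} then t powr (- 1 - \<alpha>) else 0) \<partial>lborel)"
  proof (rule nn_integral_mono)
    fix t :: real
    consider "t \<le> 0" | "0 < t" "t < 1" | "1 \<le> t" by linarith
    then show "ennreal (indicator {0<..} t * (t powr (- 1 - \<alpha>) * (1 - cos t))) \<le>
       ennreal (if t \<in> {0..1} then t powr (1 - \<alpha>) else 0) + 2 * ennreal (if t \<in> {1..} then t powr (- 1 - \<alpha>) else 0)"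
    proof cases
      case 2
      have "1 - cos t \<le> t\<^sup>2" using one_minus_cos_le[of t] zero_le_power2[of t] by linarith
      then have "t powr (- 1 - \<alpha>) * (1 - cos t) \<le> t powr (- 1 - \<alpha>) * t powr 2"
        using 2 by (intro mult_left_mono) simp_all
      also have "\<dots> = t powr (1 - \<alpha>)" by (simp flip: powr_add)
      finally show ?thesis using 2 by (auto intro: ennreal_leI)
    next
      case 3
      have "t powr (- 1 - \<alpha>) * (1 - cos t) \<le> t powr (- 1 - \<alpha>) * 2"
        using cos_ge_minus_one[of t] by (intro mult_left_mono) auto
      then have "ennreal (t powr (- 1 - \<alpha>) * (1 - cos t)) \<le> 2 * ennreal (t powr (- 1 - \<alpha>))"
        by (subst ennreal_numeral[symmetric], subst ennreal_mult[symmetric]) (auto intro: ennreal_leI simp: mult.commute)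
      then show ?thesis using 3 by (auto intro: order_trans)
    qed simp
  qed
  also have "\<dots> = (\<integral>\<^sup>+ t. ennreal (if t \<in> {0..1} then t powr (1 - \<alpha>) else 0) \<partial>lborel)
      + 2 * (\<integral>\<^sup>+ t. ennreal (if t \<in> {1..} then t powr (- 1 - \<alpha>) else 0) \<partial>lborel)"
    by (subst nn_integral_add) (auto simp: nn_integral_cmult)
  also have "\<dots> < \<infinity>" unfolding 1 2 by (simp add: ennreal_mult_less_top)
  finally show ?thesis .
qed

text \<open>The integral is even in \<xi> and homogeneous of degree \<alpha>, as scaling
  \<open>t\<close> shows; \<open>C\<close> is its value at \<open>\<xi> = 1\<close>.\<close>

lemma abs_powr_eq_cosine_integral:
  fixes \<alpha> :: real
  assumes \<alpha>: "0 < \<alpha>" "\<alpha> < 2"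
  obtains C where "0 < C"
    "\<And>\<xi>. (\<integral>\<^sup>+ t. ennreal (indicator {0<..} t * (t powr (- 1 - \<alpha>) * (1 - cos (t * \<xi>)))) \<partial>lborel) = ennreal (C * \<bar>\<xi>\<bar> powr \<alpha>)"
proof -
  define f where "f t = indicator {0<..} t * (t powr (- 1 - \<alpha>) * (1 - cos t))" for t :: real
  have [measurable]: "f \<in> borel_measurable borel" unfolding f_def by measurable
  define C where "C = enn2real (\<integral>\<^sup>+ t. ennreal (f t) \<partial>lborel)"
  have C: "(\<integral>\<^sup>+ t. ennreal (f t) \<partial>lborel) = ennreal C"
    using nn_integral_powr_cosine_finite[OF \<alpha>] by (simp add: C_def f_def)
  have pos: "0 < C"
  proof -
    \<comment> \<open>On \<open>[1, 2]\<close> the power is smallest at 2 and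
      \<open>1 - cos t\<close> is smallest at 1, since \<open>2 < pi\<close>.\<close>
    define c where "c = 2 powr (- 1 - \<alpha>) * (1 - cos 1)"
    have "cos 1 < cos (0::real)" by (rule cos_monotone_0_pi) (use pi_gt3 in auto)
    then have c: "0 < c" by (simp add: c_def)
    have "ennreal c = (\<integral>\<^sup>+ t. ennreal c * indicator {1..2::real} t \<partial>lborel)"
      by (simp add: nn_integral_cmult_indicator)
    also have "\<dots> \<le> (\<integral>\<^sup>+ t. ennreal (f t) \<partial>lborel)"
    proof (rule nn_integral_mono)
      fix t :: real
      show "ennreal c * indicator {1..2} t \<le> ennreal (f t)"
      proof (cases "t \<in> {1..2}")
        case True
        have "cos t \<le> cos 1" using True pi_gt3 by (intro cos_monotone_0_pi_le) auto
        then have "c \<le> t powr (- 1 - \<alpha>) * (1 - cos t)"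
          unfolding c_def using True \<alpha> by (intro mult_mono powr_mono2') auto
        then show ?thesis using True by (auto simp: f_def intro: ennreal_leI)
      qed simp
    qed
    finally show ?thesis using c unfolding C by (simp add: ennreal_le_iff2)
  qed
  have "(\<integral>\<^sup>+ t. ennreal (indicator {0<..} t * (t powr (- 1 - \<alpha>) * (1 - cos (t * \<xi>)))) \<partial>lborel) = ennreal (C * \<bar>\<xi>\<bar> powr \<alpha>)" for \<xi>
  proof (cases "\<xi> = 0")
    case False
    then have x: "0 < \<bar>\<xi>\<bar>" by simp
    have "indicator {0<..} t * (t powr (- 1 - \<alpha>) * (1 - cos (t * \<xi>))) = \<bar>\<xi>\<bar> powr (1 + \<alpha>) * f (\<bar>\<xi>\<bar> * t)" for t :: real
    proof (cases "0 < t")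
      case True
      have "cos (t * \<xi>) = cos (\<bar>\<xi>\<bar> * t)"
        by (cases "0 \<le> \<xi>") (auto simp: mult.commute)
      moreover have "\<bar>\<xi>\<bar> powr (1 + \<alpha>) * (\<bar>\<xi>\<bar> * t) powr (- 1 - \<alpha>) = t powr (- 1 - \<alpha>)"
        using x True by (simp add: powr_mult flip: powr_add mult.assoc)
      ultimately show ?thesis using True x by (simp add: f_def zero_less_mult_iff)
    next
      case f: False
      then have "\<not> 0 < \<bar>\<xi>\<bar> * t" using x by (simp add: zero_less_mult_iff)
      with f show ?thesis by (simp add: f_def)
    qed
    then have "(\<integral>\<^sup>+ t. ennreal (indicator {0<..} t * (t powr (- 1 - \<alpha>) * (1 - cos (t * \<xi>)))) \<partial>lborel)
        = (\<integral>\<^sup>+ t. ennreal (\<bar>\<xi>\<bar> powr (1 + \<alpha>)) * ennreal (f (\<bar>\<xi>\<bar> * t)) \<partial>lborel)"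
      by (intro nn_integral_cong) (simp add: ennreal_mult')
    also have "\<dots> = ennreal (\<bar>\<xi>\<bar> powr (1 + \<alpha>)) * (\<integral>\<^sup>+ t. ennreal (f (\<bar>\<xi>\<bar> * t)) \<partial>lborel)"
      by (rule nn_integral_cmult) measurable
    \<comment> \<open>One factor \<open>\<bar>\<xi>\<bar>\<close> is split off to be absorbed as the
      Jacobian of the scaling.\<close>
    also have "ennreal (\<bar>\<xi>\<bar> powr (1 + \<alpha>)) = ennreal (\<bar>\<xi>\<bar> powr \<alpha>) * ennreal \<bar>\<xi>\<bar>"
      using x by (simp add: powr_add mult.commute flip: ennreal_mult)
    also have "ennreal (\<bar>\<xi>\<bar> powr \<alpha>) * ennreal \<bar>\<xi>\<bar> * (\<integral>\<^sup>+ t. ennreal (f (\<bar>\<xi>\<bar> * t)) \<partial>lborel)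
        = ennreal (\<bar>\<xi>\<bar> powr \<alpha>) * (\<integral>\<^sup>+ t. ennreal (f t) \<partial>lborel)"
      using x by (subst (2) nn_integral_real_affine[where c="\<bar>\<xi>\<bar>" and t=0]) (auto simp: mult.assoc)
    also have "\<dots> = ennreal (C * \<bar>\<xi>\<bar> powr \<alpha>)"
      unfolding C using pos by (simp add: mult.commute flip: ennreal_mult)
    finally show ?thesis .
  qed simp
  with pos show ?thesis by (rule that)
qed

text \<open>Insert the cosine representation of the symbol and exchange the integrals: the result is
  an integral over \<open>t\<close> of the nonnegative quantities in the last hypothesis with
  nonnegative weights.\<close>

lemma integral_abs_powr_nonneg_less_2:
  fixes \<alpha> :: real and G :: "real \<Rightarrow> real"
  assumes \<alpha>: "0 < \<alpha>" "\<alpha> < 2"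
    and [measurable]: "G \<in> borel_measurable borel"
    and int: "integrable lborel (\<lambda>\<xi>. \<bar>\<xi>\<bar> powr \<alpha> * G \<xi>)"
    and nonneg: "\<And>t. 0 \<le> (LINT \<xi>|lborel. (1 - cos (t * \<xi>)) * G \<xi>)"
  shows "0 \<le> (LINT \<xi>|lborel. \<bar>\<xi>\<bar> powr \<alpha> * G \<xi>)"
proof -
  obtain C where C: "0 < C" and
    eq: "\<And>\<xi>. (\<integral>\<^sup>+ t. ennreal (indicator {0<..} t * (t powr (- 1 - \<alpha>) * (1 - cos (t * \<xi>)))) \<partial>lborel) = ennreal (C * \<bar>\<xi>\<bar> powr \<alpha>)"
    using abs_powr_eq_cosine_integral[OF \<alpha>] by blast
  define W where "W t \<xi> = indicator {0<..} t * (t powr (- 1 - \<alpha>) * (1 - cos (t * \<xi>)))" for t \<xi> :: real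
  have [measurable]: "(\<lambda>(t, \<xi>). W t \<xi>) \<in> borel_measurable (borel \<Otimes>\<^sub>M borel)" unfolding W_def by measurable
  have W0: "0 \<le> W t \<xi>" for t \<xi> unfolding W_def by simp
  have W: "integrable lborel (\<lambda>t. W t \<xi>)" "(LINT t|lborel. W t \<xi>) = C * \<bar>\<xi>\<bar> powr \<alpha>" for \<xi>
    using nn_integral_eq_integrable[of "\<lambda>t. W t \<xi>" lborel "C * \<bar>\<xi>\<bar> powr \<alpha>"] eq[of \<xi>] W0 C
    by (auto simp: W_def[symmetric])
  \<comment> \<open>As \<open>W\<close> is nonnegative, integrating the modulus over
    \<open>t\<close> gives \<open>C\<close> times the modulus of the integrand in
    \<open>int\<close>, which is integrable.\<close>
  have "integrable (lborel \<Otimes>\<^sub>M lborel) (\<lambda>(\<xi>, t). W t \<xi> * G \<xi>)"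
  proof (rule lborel_pair.Fubini_integrable, goal_cases)
    case 2
    have "(\<lambda>\<xi>. LINT t|lborel. norm (case (\<xi>, t) of (\<xi>, t) \<Rightarrow> W t \<xi> * G \<xi>)) = (\<lambda>\<xi>. C * \<bar>\<bar>\<xi>\<bar> powr \<alpha> * G \<xi>\<bar>)"
      using W0 by (auto simp: abs_mult W(2))
    then show ?case using int by simp
  next
    case 3 show ?case using W(1) by simp
  qed measurable
  from lborel_pair.Fubini_integral[OF this]
  have "(LINT t|lborel. LINT \<xi>|lborel. W t \<xi> * G \<xi>) = C * (LINT \<xi>|lborel. \<bar>\<xi>\<bar> powr \<alpha> * G \<xi>)"
    by (simp add: W(2) mult.assoc)
  moreover have "(LINT \<xi>|lborel. W t \<xi> * G \<xi>) = indicator {0<..} t * t powr (- 1 - \<alpha>) * (LINT \<xi>|lborel. (1 - cos (t * \<xi>)) * G \<xi>)" for t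
    unfolding W_def by (simp add: mult.assoc flip: integral_mult_right_zero)
  ultimately have "0 \<le> C * (LINT \<xi>|lborel. \<bar>\<xi>\<bar> powr \<alpha> * G \<xi>)"
    using nonneg by (metis (no_types, lifting) integral_nonneg_AE AE_I2 mult_nonneg_nonneg indicator_pos_le powr_ge_zero)
  then show ?thesis using C by (simp add: zero_le_mult_iff)
qed

text \<open>For exponent 2 the cosine integral diverges at 0. Instead, with
  \<open>N = Suc n\<close>, the multiple \<open>2 * N\<^sup>2\<close> of
  \<open>1 - cos (\<xi> / N)\<close> is dominated by \<open>\<xi>\<^sup>2\<close> and converges to
  it.\<close>

lemma integral_square_nonneg:
  fixes G :: "real \<Rightarrow> real"
  assumes [measurable]: "G \<in> borel_measurable borel"
    and int: "integrable lborel (\<lambda>\<xi>. \<xi>\<^sup>2 * G \<xi>)"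
    and nonneg: "\<And>t. 0 \<le> (LINT \<xi>|lborel. (1 - cos (t * \<xi>)) * G \<xi>)"
  shows "0 \<le> (LINT \<xi>|lborel. \<xi>\<^sup>2 * G \<xi>)"
proof (rule LIMSEQ_le_const)
  define D where "D n \<xi> = 2 * (real (Suc n))\<^sup>2 * (1 - cos (1 / real (Suc n) * \<xi>))" for n and \<xi> :: real
  have [measurable]: "D n \<in> borel_measurable borel" for n unfolding D_def by measurable
  have D0: "0 \<le> D n \<xi>" for n \<xi> unfolding D_def by simp
  have D_le: "D n \<xi> \<le> \<xi>\<^sup>2" for n \<xi>
  proof -
    have "D n \<xi> \<le> 2 * (real (Suc n))\<^sup>2 * ((1 / real (Suc n) * \<xi>)\<^sup>2 / 2)"
      unfolding D_def by (intro mult_left_mono one_minus_cos_le) simp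
    also have "\<dots> = \<xi>\<^sup>2" by (simp add: power_mult_distrib power_divide del: of_nat_Suc)
    finally show ?thesis .
  qed
  show "(\<lambda>n. LINT \<xi>|lborel. D n \<xi> * G \<xi>) \<longlonglongrightarrow> (LINT \<xi>|lborel. \<xi>\<^sup>2 * G \<xi>)"
  proof (rule integral_dominated_convergence)
    show "integrable lborel (\<lambda>\<xi>. norm (\<xi>\<^sup>2 * G \<xi>))" using int by (rule integrable_norm)
    have "(\<lambda>n. D n \<xi>) \<longlonglongrightarrow> \<xi>\<^sup>2" for \<xi>
    proof (cases "\<xi> = 0")
      case False
      then show ?thesis unfolding D_def power2_eq_square by real_asymp
    qed (simp add: D_def)
    then show "AE \<xi> in lborel. (\<lambda>n. D n \<xi> * G \<xi>) \<longlonglongrightarrow> \<xi>\<^sup>2 * G \<xi>"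
      by (intro AE_I2 tendsto_mult_right)
    show "AE \<xi> in lborel. norm (D n \<xi> * G \<xi>) \<le> norm (\<xi>\<^sup>2 * G \<xi>)" for n
      using D0 D_le by (intro AE_I2) (simp add: abs_mult mult_right_mono)
  qed measurable
  have "(LINT \<xi>|lborel. D n \<xi> * G \<xi>) = 2 * (real (Suc n))\<^sup>2 * (LINT \<xi>|lborel. (1 - cos (1 / real (Suc n) * \<xi>)) * G \<xi>)" for n
    unfolding D_def by (simp only: mult.assoc integral_mult_right_zero)
  then show "\<exists>N. \<forall>n\<ge>N. 0 \<le> (LINT \<xi>|lborel. D n \<xi> * G \<xi>)"
    using nonneg by (metis mult_nonneg_nonneg zero_le_numeral zero_le_power2)
qed

lemma integral_abs_powr_nonneg:
  fixes \<alpha> :: real and G :: "real \<Rightarrow> real"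
  assumes "0 < \<alpha>" "\<alpha> \<le> 2" "G \<in> borel_measurable borel"
    and "integrable lborel (\<lambda>\<xi>. \<bar>\<xi>\<bar> powr \<alpha> * G \<xi>)"
    and "\<And>t. 0 \<le> (LINT \<xi>|lborel. (1 - cos (t * \<xi>)) * G \<xi>)"
  shows "0 \<le> (LINT \<xi>|lborel. \<bar>\<xi>\<bar> powr \<alpha> * G \<xi>)"
proof (cases "\<alpha> = 2")
  case True
  have "\<bar>\<xi>\<bar> powr 2 = \<xi>\<^sup>2" for \<xi> :: real by (cases "\<xi> = 0") simp_all
  then show ?thesis using assms integral_square_nonneg[of G] True by simp
next
  case False
  then show ?thesis using assms by (intro integral_abs_powr_nonneg_less_2) auto
qed

section \<open>Correlations of a power of \<open>v\<close> with translates of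
  \<open>v\<close>\<close>

lemma FT_modulate: "FT (\<lambda>\<xi>. cis (t * \<xi>) * g \<xi>) x = FT g (x - t)"
  unfolding FT_def by (simp add: cis_mult algebra_simps flip: mult.assoc)

text \<open>The exponent \<open>n - 1\<close> is odd, so \<open>a ^ (n - 1)\<close> is increasing in
  \<open>a\<close> and \<open>(a ^ (n - 1) - b ^ (n - 1)) * (a - b)\<close> is nonnegative. Take
  \<open>a = v x\<close>, \<open>b = v (x + t)\<close> and integrate, using translation
  invariance.\<close>

lemma integral_correlation_le:
  fixes v :: "real \<Rightarrow> real" and n :: nat
  assumes [measurable]: "v \<in> borel_measurable borel" and "even n" "0 < n"
    and i: "integrable lborel (\<lambda>x. v x ^ n)"
  shows "(LINT x|lborel. v x ^ (n - 1) * v (x + t)) + (LINT x|lborel. v x ^ (n - 1) * v (x - t)) \<le> 2 * (LINT x|lborel. v x ^ n)"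
proof -
  obtain m where m: "n = Suc m" "odd m" using assms by (cases n) auto
  have shift: "integrable lborel (\<lambda>x. v (x + t) ^ n)" for t
    using lborel_integrable_real_affine[OF i, of 1 t] by (simp add: add.commute)
  have corr: "integrable lborel (\<lambda>x. v x ^ m * v (x + t))" for t
  proof (rule Bochner_Integration.integrable_bound)
    show "integrable lborel (\<lambda>x. v x ^ n + v (x + t) ^ n)" using i shift by simp
    \<comment> \<open>Replace both factors by the larger modulus, whose \<open>n\<close>-th power is
      one of the two summands.\<close>
    have "\<bar>a ^ m * b\<bar> \<le> a ^ n + b ^ n" for a b :: real
    proof -
      have "\<bar>a\<bar> ^ m * \<bar>b\<bar> \<le> (max \<bar>a\<bar> \<bar>b\<bar>) ^ m * max \<bar>a\<bar> \<bar>b\<bar>" by (intro mult_mono power_mono) auto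
      also have "\<dots> = (max \<bar>a\<bar> \<bar>b\<bar>) ^ n" by (simp add: m mult.commute)
      also have "\<dots> \<le> \<bar>a\<bar> ^ n + \<bar>b\<bar> ^ n" by (simp add: max_def)
      finally show ?thesis using \<open>even n\<close> by (simp add: abs_mult power_abs power_even_abs)
    qed
    then show "AE x in lborel. norm (v x ^ m * v (x + t)) \<le> norm (v x ^ n + v (x + t) ^ n)"
      by (intro AE_I2) (metis abs_ge_self order_trans real_norm_def)
  qed measurable
  have corr': "integrable lborel (\<lambda>x. v (x + t) ^ m * v x)"
    using lborel_integrable_real_affine[OF corr[of "- t"], of 1 t] by (simp add: add.commute)
  \<comment> \<open>Translation by \<open>t\<close> exchanges the roles of the two points, so the
    two correlations together become symmetric in \<open>v x\<close> and
    \<open>v (x + t)\<close>.\<close>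
  have eq: "(LINT x|lborel. v x ^ m * v (x - t)) = (LINT x|lborel. v (x + t) ^ m * v x)"
    by (subst lborel_integral_real_affine[where c=1 and t=t]) (simp_all add: add.commute)
  have eqn: "(LINT x|lborel. v (x + t) ^ n) = (LINT x|lborel. v x ^ n)"
    by (subst (2) lborel_integral_real_affine[where c=1 and t=t]) (simp_all add: add.commute)
  have ineq: "a ^ m * b + b ^ m * a \<le> a ^ n + b ^ n" for a b :: real
  proof -
    have "0 \<le> (a ^ m - b ^ m) * (a - b)"
      using power_mono_odd[OF m(2), of a b] power_mono_odd[OF m(2), of b a]
      by (cases "a \<le> b") (auto intro: mult_nonpos_nonpos mult_nonneg_nonneg)
    then show ?thesis by (simp add: m algebra_simps)
  qed
  have "(LINT x|lborel. v x ^ m * v (x + t)) + (LINT x|lborel. v (x + t) ^ m * v x)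
      = (LINT x|lborel. v x ^ m * v (x + t) + v (x + t) ^ m * v x)"
    using corr corr' by simp
  also have "\<dots> \<le> (LINT x|lborel. v x ^ n + v (x + t) ^ n)"
    using corr corr' i shift by (intro integral_mono) (auto intro: ineq)
  also have "\<dots> = 2 * (LINT x|lborel. v x ^ n)"
    using i shift by (simp add: eqn)
  finally show "(LINT x|lborel. v x ^ (n - 1) * v (x + t)) + (LINT x|lborel. v x ^ (n - 1) * v (x - t)) \<le> 2 * (LINT x|lborel. v x ^ n)"
    by (simp add: m eq)
qed

section \<open>Integrability and Cauchy-Schwarz for real functions\<close>

lemma integrable_inverse_1_plus_square: "integrable lborel (\<lambda>x::real. 1 / (1 + x\<^sup>2))"
proof -
  have "(\<integral>\<^sup>+ x. ennreal (1 / (1 + x\<^sup>2)) * indicator {0..} x \<partial>lborel) = ennreal (pi / 2 - arctan 0)"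
    by (rule nn_integral_FTC_atLeast[OF _ _ _ tendsto_arctan_at_top])
      (auto intro!: derivative_eq_intros simp: field_simps)
  then have nn: "(\<integral>\<^sup>+ x. ennreal (indicator {0..} x / (1 + x\<^sup>2)) \<partial>lborel) < \<infinity>"
    by (simp add: ennreal_indicator mult.commute ennreal_mult'[symmetric] flip: ennreal_indicator)
  have i: "integrable lborel (\<lambda>x::real. indicator {0..} x / (1 + x\<^sup>2))"
    unfolding integrable_iff_bounded using nn by simp
  \<comment> \<open>Both half-lines contain 0, so the sum only dominates the function; this is all
    that is needed.\<close>
  have "integrable lborel (\<lambda>x::real. indicator {0..} x / (1 + x\<^sup>2) + indicator {0..} (- x) / (1 + (- x)\<^sup>2))"
    using i lborel_integrable_real_affine[OF i, of "-1" 0] by simp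
  then show ?thesis
    by (rule Bochner_Integration.integrable_bound) (auto simp: indicator_def)
qed

lemma integrable_mult_L2_real:
  fixes f g :: "real \<Rightarrow> real"
  assumes "square_integrable (\<lambda>x. complex_of_real (f x))" "square_integrable (\<lambda>x. complex_of_real (g x))"
  shows "integrable lborel (\<lambda>x. f x * g x)"
  using integrable_mult_square_integrable[OF assms] by (simp only: of_real_mult[symmetric] complex_of_real_integrable_eq)

lemma Cauchy_Schwarz_L2_real:
  fixes f g :: "real \<Rightarrow> real"
  assumes f: "square_integrable (\<lambda>x. complex_of_real (f x))" and g: "square_integrable (\<lambda>x. complex_of_real (g x))"
  shows "(LINT x|lborel. f x * g x)\<^sup>2 \<le> (LINT x|lborel. (f x)\<^sup>2) * (LINT x|lborel. (g x)\<^sup>2)"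
proof -
  have "(LINT x|lborel. complex_of_real (f x) * of_real (g x)) = of_real (LINT x|lborel. f x * g x)"
    by (simp only: of_real_mult[symmetric] integral_complex_of_real)
  then have "ennreal ((LINT x|lborel. f x * g x)\<^sup>2) \<le> ennreal (LINT x|lborel. (f x)\<^sup>2) * ennreal (LINT x|lborel. (g x)\<^sup>2)"
    using Cauchy_Schwarz_l2sq[of "\<lambda>x. complex_of_real (f x)" "\<lambda>x. complex_of_real (g x)"] f g
    by (simp add: l2sq_eq ennreal_power square_integrable_measurable)
  then show ?thesis by (simp add: integral_nonneg ennreal_le_iff flip: ennreal_mult)
qed

section \<open>Positivity of the pairing of a power of \<open>v\<close> with its fractional
  derivative\<close>

lemma integral_FT_reflect_exchange:
  assumes p: "integrable lborel p" and h: "integrable lborel h"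
  shows "(LINT x|lborel. p x * FT h (- x)) = (LINT \<xi>|lborel. FT p (- \<xi>) * h \<xi>)"
proof -
  have hr: "integrable lborel (\<lambda>x. h (- x))"
    using lborel_integrable_real_affine[OF h, of "-1" 0] by simp
  have "(LINT x|lborel. p x * FT h (- x)) = (LINT \<xi>|lborel. FT p \<xi> * h (- \<xi>))"
    unfolding FT_reflect[of h] by (rule FT_exchange[OF p hr, symmetric])
  also have "\<dots> = (LINT \<xi>|lborel. FT p (- \<xi>) * h \<xi>)"
    by (subst lborel_integral_real_affine[where c="-1" and t=0]) simp_all
  finally show ?thesis .
qed

text \<open>On the frequency side the integral is that of
  \<open>\<bar>\<xi>\<bar> powr \<alpha>\<close> against \<open>G\<close>. Testing \<open>G\<close>
  with \<open>1 - cos (t * \<xi>)\<close> gives a combination of correlations of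
  \<open>v ^ (n - 1)\<close> with translates of \<open>v\<close>, which is nonnegative by
  monotonicity of the power.\<close>

lemma integral_power_frac_deriv_nonneg:
  fixes v :: "real \<Rightarrow> real" and \<alpha> :: real and n :: nat
  assumes vg: "has_fourier (\<lambda>x. complex_of_real (v x)) g" and g: "integrable lborel g"
    and hu: "has_inv_fourier (\<lambda>\<xi>. of_real (\<bar>\<xi>\<bar> powr \<alpha>) * g \<xi>) u"
    and h: "integrable lborel (\<lambda>\<xi>. of_real (\<bar>\<xi>\<bar> powr \<alpha>) * g \<xi>)"
    and \<alpha>: "0 < \<alpha>" "\<alpha> \<le> 2" and n: "even n" "0 < n"
    and vn: "integrable lborel (\<lambda>x. v x ^ n)" and vn1: "integrable lborel (\<lambda>x. v x ^ (n - 1))"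
  shows "0 \<le> (LINT x|lborel. v x ^ (n - 1) * Re (u x))"
proof -
  define p where "p x = complex_of_real (v x ^ (n - 1))" for x
  have [measurable]: "g \<in> borel_measurable borel" "u \<in> borel_measurable borel"
    using g hu by (auto simp: has_inv_fourier_def)
  have "(\<lambda>x. complex_of_real (v x)) \<in> borel_measurable borel" using vg by (auto simp: has_fourier_def)
  then have [measurable]: "v \<in> borel_measurable borel" by (simp add: borel_measurable_complex_iff)
  have p: "integrable lborel p" unfolding p_def complex_of_real_integrable_eq by (rule vn1)
  then have [measurable]: "p \<in> borel_measurable borel" by auto
  define c where "c t = (LINT x|lborel. v x ^ (n - 1) * v (x + t))" for t
  have cis_g: "integrable lborel (\<lambda>\<xi>. cis (t * \<xi>) * g \<xi>)" for t
    by (rule integrable_cis_mult[OF g]) simp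
  have pg: "integrable lborel (\<lambda>\<xi>. FT p (- \<xi>) * k \<xi>)" if "integrable lborel k" for k
    by (rule integrable_bounded_mult[OF that _ norm_FT_le]) measurable
  \<comment> \<open>Modulation by \<open>cis (t * \<xi>)\<close> translates the inverse integral of
    \<open>g\<close>, which the inversion formula identifies with \<open>v (x + t)\<close>.\<close>
  have corr: "(LINT \<xi>|lborel. FT p (- \<xi>) * (cis (t * \<xi>) * g \<xi>)) = of_real (2 * pi * c t)" for t
  proof -
    have "AE x in lborel. complex_of_real (v (t + 1 * x)) = FT g (- (t + 1 * x)) / of_real (2 * pi)"
      by (rule AE_borel_affine[OF _ _ Fourier_inversion[OF vg g]]) simp_all
    then have ae: "AE x in lborel. p x * FT g (- x - t) = of_real (2 * pi) * of_real (v x ^ (n - 1) * v (x + t))"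
      by eventually_elim (simp add: p_def field_simps)
    have "(LINT \<xi>|lborel. FT p (- \<xi>) * (cis (t * \<xi>) * g \<xi>)) = (LINT x|lborel. p x * FT g (- x - t))"
      using integral_FT_reflect_exchange[OF p cis_g[of t]] by (simp add: FT_modulate)
    also have "\<dots> = (LINT x|lborel. of_real (2 * pi) * of_real (v x ^ (n - 1) * v (x + t)))"
      by (rule integral_cong_AE[OF _ _ ae]) measurable
    also have "\<dots> = of_real (2 * pi) * of_real (c t)"
      unfolding c_def by (simp only: integral_mult_right_zero integral_complex_of_real)
    finally show ?thesis by simp
  qed
  define G where "G \<xi> = Re (FT p (- \<xi>) * g \<xi>)" for \<xi>
  have [measurable]: "G \<in> borel_measurable borel" unfolding G_def by measurable
  have scale: "m * G \<xi> = Re (FT p (- \<xi>) * (of_real m * g \<xi>))" for m \<xi>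
    unfolding G_def by (simp add: algebra_simps)
  have Re_combination: "(LINT \<xi>|lborel. Re (p \<xi> - (q \<xi> + r \<xi>) / 2)) =
      Re ((LINT \<xi>|lborel. p \<xi>) - ((LINT \<xi>|lborel. q \<xi>) + (LINT \<xi>|lborel. r \<xi>)) / 2)"
    if "integrable lborel p" "integrable lborel q" "integrable lborel r" for p q r :: "real \<Rightarrow> complex"
    using that by (subst integral_Re) simp_all
  have "0 \<le> (LINT \<xi>|lborel. \<bar>\<xi>\<bar> powr \<alpha> * G \<xi>)"
  proof (rule integral_abs_powr_nonneg[OF \<alpha>])
    show "integrable lborel (\<lambda>\<xi>. \<bar>\<xi>\<bar> powr \<alpha> * G \<xi>)"
      unfolding scale using pg[OF h] by (rule integrable_Re)
    fix t
    \<comment> \<open>The cosine is the mean of two opposite modulations and the constant 1 is the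
      modulation with \<open>t = 0\<close>, so only correlations remain.\<close>
    have "(LINT \<xi>|lborel. (1 - cos (t * \<xi>)) * G \<xi>) =
      (LINT \<xi>|lborel. Re (FT p (- \<xi>) * (cis (0 * \<xi>) * g \<xi>) - (FT p (- \<xi>) * (cis (t * \<xi>) * g \<xi>) + FT p (- \<xi>) * (cis (- t * \<xi>) * g \<xi>)) / 2))"
    proof (rule Bochner_Integration.integral_cong)
      fix \<xi>
      have "complex_of_real (1 - cos (t * \<xi>)) = cis (0 * \<xi>) - (cis (t * \<xi>) + cis (- t * \<xi>)) / 2"
        by (simp add: complex_eq_iff)
      then show "(1 - cos (t * \<xi>)) * G \<xi> = Re (FT p (- \<xi>) * (cis (0 * \<xi>) * g \<xi>) - (FT p (- \<xi>) * (cis (t * \<xi>) * g \<xi>) + FT p (- \<xi>) * (cis (- t * \<xi>) * g \<xi>)) / 2)"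
        unfolding scale by (simp only: algebra_simps add_divide_distrib) (simp add: field_simps)
    qed simp
    also have "\<dots> = Re (of_real (2 * pi * c 0) - (of_real (2 * pi * c t) + of_real (2 * pi * c (- t))) / 2)"
      unfolding corr[symmetric]
      by (rule Re_combination; rule pg[OF cis_g])
    also have "\<dots> = 2 * pi * (c 0 - (c t + c (- t)) / 2)"
      by (simp add: algebra_simps add_divide_distrib)
    also have "0 \<le> \<dots>"
    proof -
      \<comment> \<open>This identifies \<open>c 0\<close> with the integral of
        \<open>v x ^ n\<close>.\<close>
      have "v x ^ (n - 1) * v x = v x ^ n" for x using n by (cases n) (simp_all add: mult.commute)
      then have "c t + c (- t) \<le> 2 * c 0"
        using integral_correlation_le[OF _ n vn, of t] by (simp add: c_def)
      then show ?thesis by simp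
    qed
    finally show "0 \<le> (LINT \<xi>|lborel. (1 - cos (t * \<xi>)) * G \<xi>)" .
  qed measurable
  \<comment> \<open>Back to the space side, where the inverse integral of the multiplied transform
    is \<open>2 * pi * u\<close> almost everywhere.\<close>
  also have "(LINT \<xi>|lborel. \<bar>\<xi>\<bar> powr \<alpha> * G \<xi>) = Re (LINT \<xi>|lborel. FT p (- \<xi>) * (of_real (\<bar>\<xi>\<bar> powr \<alpha>) * g \<xi>))"
    unfolding scale by (rule integral_Re[OF pg[OF h]])
  also have "(LINT \<xi>|lborel. FT p (- \<xi>) * (of_real (\<bar>\<xi>\<bar> powr \<alpha>) * g \<xi>)) = (LINT x|lborel. p x * FT (\<lambda>\<xi>. of_real (\<bar>\<xi>\<bar> powr \<alpha>) * g \<xi>) (- x))"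
    by (rule integral_FT_reflect_exchange[OF p h, symmetric])
  also have "Re \<dots> = (LINT x|lborel. Re (p x * FT (\<lambda>\<xi>. of_real (\<bar>\<xi>\<bar> powr \<alpha>) * g \<xi>) (- x)))"
  proof (rule integral_Re[symmetric])
    have "integrable lborel (\<lambda>x. FT (\<lambda>\<xi>. of_real (\<bar>\<xi>\<bar> powr \<alpha>) * g \<xi>) (- x) * p x)"
      by (rule integrable_bounded_mult[OF p _ norm_FT_le]) measurable
    then show "integrable lborel (\<lambda>x. p x * FT (\<lambda>\<xi>. of_real (\<bar>\<xi>\<bar> powr \<alpha>) * g \<xi>) (- x))"
      by (simp add: mult.commute)
  qed
  also have "\<dots> = (LINT x|lborel. 2 * pi * (v x ^ (n - 1) * Re (u x)))"
  proof (rule integral_cong_AE)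
    show "AE x in lborel. Re (p x * FT (\<lambda>\<xi>. of_real (\<bar>\<xi>\<bar> powr \<alpha>) * g \<xi>) (- x)) = 2 * pi * (v x ^ (n - 1) * Re (u x))"
      using has_inv_fourier_FT[OF hu h] by eventually_elim (simp add: p_def)
  qed measurable
  also have "\<dots> = 2 * pi * (LINT x|lborel. v x ^ (n - 1) * Re (u x))"
    by (rule integral_mult_right_zero)
  finally have "2 * pi * 0 \<le> 2 * pi * (LINT x|lborel. v x ^ (n - 1) * Re (u x))" by simp
  then show ?thesis by (rule mult_left_le_imp_le) simp
qed

subsection \<open>Functions in Sobolev spaces\<close>

lemma abs_powr_le_weight:
  fixes \<xi> \<beta> :: real
  assumes "0 \<le> \<beta>"
  shows "\<bar>\<xi>\<bar> powr \<beta> \<le> (1 + \<xi>\<^sup>2) powr (\<beta> / 2)"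
proof (cases "\<xi> = 0")
  case False
  have "\<bar>\<xi>\<bar> powr \<beta> = (\<bar>\<xi>\<bar> powr 2) powr (\<beta> / 2)" by (subst powr_powr) simp
  also have "\<bar>\<xi>\<bar> powr 2 = \<xi>\<^sup>2" using False by simp
  also have "(\<xi>\<^sup>2) powr (\<beta> / 2) \<le> (1 + \<xi>\<^sup>2) powr (\<beta> / 2)"
    using assms by (intro powr_mono2) auto
  finally show ?thesis .
qed simp

text \<open>Of the order \<open>2 * \<alpha>\<close> of regularity, the multiplier uses at most
  \<alpha>. The remaining weight of order \<open>- \<alpha>\<close> is square integrable because
  \<open>1 \<le> \<alpha>\<close>, so the product is dominated by a sum of two integrable
  squares.\<close>

lemma integrable_sobolev_multiplier:
  fixes m :: "real \<Rightarrow> real"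
  assumes \<alpha>: "1 \<le> \<alpha>" and [measurable]: "m \<in> borel_measurable borel" "g \<in> borel_measurable borel"
    and S: "square_integrable (\<lambda>\<xi>. of_real ((1 + \<xi>\<^sup>2) powr \<alpha>) * g \<xi>)"
    and m: "\<And>\<xi>. \<bar>m \<xi>\<bar> \<le> (1 + \<xi>\<^sup>2) powr (\<alpha> / 2)"
  shows "integrable lborel (\<lambda>\<xi>. of_real (m \<xi>) * g \<xi>)"
proof (rule Bochner_Integration.integrable_bound)
  let ?G = "\<lambda>\<xi>. of_real ((1 + \<xi>\<^sup>2) powr \<alpha>) * g \<xi>"
  show "integrable lborel (\<lambda>\<xi>. 1 / (1 + \<xi>\<^sup>2) + (cmod (?G \<xi>))\<^sup>2)"
    using S integrable_inverse_1_plus_square by (simp add: square_integrable_def)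
  show "AE \<xi> in lborel. norm (of_real (m \<xi>) * g \<xi>) \<le> norm (1 / (1 + \<xi>\<^sup>2) + (cmod (?G \<xi>))\<^sup>2)"
  proof (rule AE_I2)
    fix \<xi> :: real
    have pos: "0 < 1 + \<xi>\<^sup>2" by (simp add: add_pos_nonneg)
    define a where "a = (1 + \<xi>\<^sup>2) powr (- \<alpha> / 2)"
    define b where "b = cmod (?G \<xi>)"
    have b: "b = (1 + \<xi>\<^sup>2) powr \<alpha> * cmod (g \<xi>)" by (simp add: b_def norm_mult)
    have ab: "a * b = (1 + \<xi>\<^sup>2) powr (\<alpha> / 2) * cmod (g \<xi>)"
      by (simp add: a_def b mult.assoc[symmetric] powr_add[symmetric])
    have "norm (of_real (m \<xi>) * g \<xi>) \<le> a * b"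
      unfolding ab by (simp add: norm_mult mult_right_mono m)
    also have "a * b \<le> a\<^sup>2 + b\<^sup>2"
    proof -
      have "0 \<le> a * b" by (simp add: a_def b_def)
      then show ?thesis using sum_squares_bound[of a b] by linarith
    qed
    also have "a\<^sup>2 \<le> 1 / (1 + \<xi>\<^sup>2)"
    proof -
      have "a\<^sup>2 = (1 + \<xi>\<^sup>2) powr (- \<alpha>)" by (simp add: a_def power2_eq_square flip: powr_add)
      also have "\<dots> \<le> (1 + \<xi>\<^sup>2) powr (- 1)" using \<alpha> by (intro powr_mono) auto
      also have "\<dots> = 1 / (1 + \<xi>\<^sup>2)" using pos by (simp add: powr_minus_divide)
      finally show ?thesis .
    qed
    finally show "norm (of_real (m \<xi>) * g \<xi>) \<le> norm (1 / (1 + \<xi>\<^sup>2) + (cmod (?G \<xi>))\<^sup>2)"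
      using pos by (simp add: b_def)
  qed
qed measurable

text \<open>As \<open>v\<close> is real, the real part can be taken after integrating. Parseval then
  produces \<open>m \<xi>\<close> times the squared modulus of \<open>g \<xi>\<close>, which is
  real.\<close>

lemma frac_deriv_pairing:
  fixes v :: "real \<Rightarrow> real"
  assumes vg: "has_fourier (\<lambda>x. complex_of_real (v x)) g"
    and hu: "has_inv_fourier (\<lambda>\<xi>. of_real (m \<xi>) * g \<xi>) u"
  shows "(LINT x|lborel. v x * Re (u x)) = (LINT \<xi>|lborel. m \<xi> * (cmod (g \<xi>))\<^sup>2) / (2 * pi)"
proof -
  have v: "square_integrable (\<lambda>x. complex_of_real (v x))" and u: "square_integrable u"
    using vg hu by (auto simp: has_fourier_def has_inv_fourier_def)
  have "(LINT x|lborel. v x * Re (u x)) = Re (LINT x|lborel. u x * cnj (of_real (v x)))"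
    using integrable_mult_square_integrable[OF u v] by (subst integral_Re[symmetric]) (simp_all add: mult.commute)
  also have "\<dots> = Re ((LINT \<xi>|lborel. of_real (m \<xi>) * g \<xi> * cnj (g \<xi>)) / of_real (2 * pi))"
    by (simp only: Parseval[OF vg hu])
  also have "(\<lambda>\<xi>. of_real (m \<xi>) * g \<xi> * cnj (g \<xi>)) = (\<lambda>\<xi>. complex_of_real (m \<xi> * (cmod (g \<xi>))\<^sup>2))"
    by (simp add: complex_norm_square mult.assoc del: of_real_power)
  also have "Re ((LINT \<xi>|lborel. complex_of_real (m \<xi> * (cmod (g \<xi>))\<^sup>2)) / of_real (2 * pi)) = (LINT \<xi>|lborel. m \<xi> * (cmod (g \<xi>))\<^sup>2) / (2 * pi)"
    by (simp only: integral_complex_of_real of_real_divide[symmetric] Re_complex_of_real)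
  finally show ?thesis .
qed

text \<open>Drop the imaginary part, replace \<open>u\<close> by the classical inverse integral, and
  apply the Bessel bound; its factor \<open>2 * pi\<close> cancels one of the two in the
  denominator.\<close>

lemma integral_Re_inv_fourier_le:
  assumes hu: "has_inv_fourier h u" and h: "integrable lborel h"
  shows "(LINT x|lborel. (Re (u x))\<^sup>2) \<le> (LINT \<xi>|lborel. (cmod (h \<xi>))\<^sup>2) / (2 * pi)"
proof -
  have h2: "square_integrable h" and u: "square_integrable u" using hu by (auto simp: has_inv_fourier_def)
  have [measurable]: "h \<in> borel_measurable borel" "u \<in> borel_measurable borel" using h2 u by auto
  have Fh: "square_integrable (FT h)" by (rule square_integrable_FT[OF h h2])
  have iu: "integrable lborel (\<lambda>x. (cmod (u x))\<^sup>2)" using u by (simp add: square_integrable_def)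
  have "(LINT x|lborel. (Re (u x))\<^sup>2) \<le> (LINT x|lborel. (cmod (u x))\<^sup>2)"
    by (rule integral_mono'[OF iu]) (auto intro: power2_le_iff_abs_le[THEN iffD2] simp: cmod_power2)
  also have "\<dots> = (LINT x|lborel. (cmod (FT h (- x)))\<^sup>2 / (2 * pi)\<^sup>2)"
    by (rule integral_cong_AE)
      (use has_inv_fourier_FT[OF hu h] in \<open>auto simp: norm_divide power_divide power_mult_distrib elim: eventually_mono\<close>)
  also have "\<dots> = (LINT x|lborel. (cmod (FT h x))\<^sup>2 / (2 * pi)\<^sup>2)"
    by (subst lborel_integral_real_affine[where c="-1" and t=0]) simp_all
  also have "\<dots> = (LINT x|lborel. (cmod (FT h x))\<^sup>2) / (2 * pi)\<^sup>2"
    by (rule integral_divide_zero)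
  also have "\<dots> \<le> (2 * pi * (LINT \<xi>|lborel. (cmod (h \<xi>))\<^sup>2)) / (2 * pi)\<^sup>2"
  proof (rule divide_right_mono)
    have "ennreal (LINT x|lborel. (cmod (FT h x))\<^sup>2) \<le> ennreal (2 * pi * (LINT \<xi>|lborel. (cmod (h \<xi>))\<^sup>2))"
      using l2sq_FT_le[OF h] by (simp add: l2sq_eq Fh h2 ennreal_mult)
    then show "(LINT x|lborel. (cmod (FT h x))\<^sup>2) \<le> 2 * pi * (LINT \<xi>|lborel. (cmod (h \<xi>))\<^sup>2)"
      by (subst (asm) ennreal_le_iff) (simp_all add: integral_nonneg)
  qed simp
  also have "\<dots> = (LINT \<xi>|lborel. (cmod (h \<xi>))\<^sup>2) / (2 * pi)" by (simp add: power2_eq_square)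
  finally show ?thesis .
qed

text \<open>
  Here \<open>s = sqrt (1 + \<alpha>)\<close>, and \<open>Z\<close> is \<open>\<integral> v D\<^bsup>2\<alpha>\<^esup> v\<close>. Only \<open>W \<le> Z\<close> is asked for the integral \<open>W\<close> of the
  squared real part of \<open>D\<^sup>\<alpha> v\<close>, so that \<open>D\<^sup>\<alpha> v\<close> need not be shown to be real.
\<close>

lemma current_inequality:
  fixes s k M A B W X Q Z :: real
  assumes s: "1 \<le> s" "s \<le> k + 1" and k: "0 < k" and nonneg: "0 \<le> M" "0 \<le> A" "0 \<le> B" "0 \<le> X" and "W \<le> Z"
    and CS: "(s * A + B)\<^sup>2 \<le> M * (s\<^sup>2 * W + 2 * s * X + Q)"
  shows "k\<^sup>2 / (2 * (k + 2)\<^sup>2) * B\<^sup>2 \<le>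
    M * (s\<^sup>2 / 2 * Z + (s\<^sup>2 + 1) / 2 * X + 1 / 2 * Q)
    - (1 / 2 * A + 1 / (k + 2) * B) * (s\<^sup>2 * A + 2 * (k + 1) / (k + 2) * B)"
proof -
  \<comment> \<open>Passing from the square in \<open>CS\<close> to the energy current costs
    \<open>s\<^sup>2 * (Z - W)\<close> and, since
    \<open>s\<^sup>2 + 1 - 2 * s = (s - 1)\<^sup>2\<close>, a nonnegative multiple of
    \<open>X\<close>.\<close>
  have "M * (s\<^sup>2 * W + 2 * s * X + Q) + M * (s\<^sup>2 * (Z - W) + (s - 1)\<^sup>2 * X) = 2 * (M * (s\<^sup>2 / 2 * Z + (s\<^sup>2 + 1) / 2 * X + 1 / 2 * Q))"
    by (simp add: algebra_simps power2_eq_square)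
  moreover have "0 \<le> M * (s\<^sup>2 * (Z - W) + (s - 1)\<^sup>2 * X)"
    using assms by (intro mult_nonneg_nonneg add_nonneg_nonneg) auto
  ultimately have 1: "(s * A + B)\<^sup>2 / 2 \<le> M * (s\<^sup>2 / 2 * Z + (s\<^sup>2 + 1) / 2 * X + 1 / 2 * Q)"
    using CS by linarith
  have "(s * A + B)\<^sup>2 / 2 - (1 / 2 * A + 1 / (k + 2) * B) * (s\<^sup>2 * A + 2 * (k + 1) / (k + 2) * B)
      - k\<^sup>2 / (2 * (k + 2)\<^sup>2) * B\<^sup>2 = (s - 1) * (k + 1 - s) / (k + 2) * (A * B)"
    using k by (simp add: divide_simps power2_eq_square) (simp add: algebra_simps)
  moreover have "0 \<le> (s - 1) * (k + 1 - s) / (k + 2) * (A * B)"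
    using assms by (intro mult_nonneg_nonneg divide_nonneg_pos) auto
  ultimately show ?thesis using 1 by linarith
qed

section \<open>The integrals of the densities and currents of a Sobolev function, and their
  comparison\<close>

theorem theorem6p5:
  fixes \<alpha> :: real and k :: nat and v :: "real \<Rightarrow> real"
  assumes "1 < \<alpha>" and "\<alpha> \<le> 2"
    and "even k" and "0 < k"
    and "(\<lambda>x. complex_of_real (v x)) \<in> sobolev (2 * \<alpha>)"
  shows "(LINT x|lborel. mass_density v x) * (LINT x|lborel. energy_current \<alpha> k v x)
         - (LINT x|lborel. energy_density \<alpha> k v x) * (LINT x|lborel. mass_current \<alpha> k v x)
         \<ge> (real k)\<^sup>2 / (2 * (real k + 2)\<^sup>2) * (LINT x|lborel. v x ^ (k + 2))\<^sup>2"
proof -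
  let ?v = "\<lambda>x. complex_of_real (v x)"
  define g where "g = fourier ?v"
  have v2: "square_integrable ?v"
    and S: "square_integrable (\<lambda>\<xi>. of_real ((1 + \<xi>\<^sup>2) powr \<alpha>) * g \<xi>)"
    using assms(5) by (auto simp: sobolev_def g_def)
  have vg: "has_fourier ?v g"
    unfolding g_def fourier_def by (rule someI_ex[OF has_fourier_exists[OF v2]])
  have [measurable]: "g \<in> borel_measurable borel" using vg by (auto simp: has_fourier_def)
  have "?v \<in> borel_measurable borel" using v2 by auto
  then have [measurable]: "v \<in> borel_measurable borel" by (simp add: borel_measurable_complex_iff)
  define h where "h \<beta> \<xi> = of_real (\<bar>\<xi>\<bar> powr \<beta>) * g \<xi>" for \<beta> \<xi>
  have [measurable]: "h \<beta> \<in> borel_measurable borel" for \<beta> unfolding h_def by measurable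
  have h2: "square_integrable (h \<beta>)" if "0 \<le> \<beta>" "\<beta> \<le> 2 * \<alpha>" for \<beta>
  proof (rule square_integrable_bound[OF S])
    have "\<bar>\<xi>\<bar> powr \<beta> \<le> (1 + \<xi>\<^sup>2) powr \<alpha>" for \<xi> :: real
      using abs_powr_le_weight[OF that(1), of \<xi>] powr_mono[of "\<beta> / 2" \<alpha> "1 + \<xi>\<^sup>2"] that by simp
    then show "AE \<xi> in lborel. cmod (h \<beta> \<xi>) \<le> cmod (of_real ((1 + \<xi>\<^sup>2) powr \<alpha>) * g \<xi>)"
      by (intro AE_I2) (simp add: h_def norm_mult mult_right_mono)
  qed measurable
  have inv: "has_inv_fourier (h \<beta>) (frac_deriv \<beta> ?v)" if "0 \<le> \<beta>" "\<beta> \<le> 2 * \<alpha>" for \<beta>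
    unfolding frac_deriv_def inv_fourier_def g_def[symmetric] h_def[abs_def]
    by (rule someI_ex[OF has_inv_fourier_exists]) (use h2[OF that] in \<open>simp add: h_def[abs_def]\<close>)
  \<comment> \<open>The multiplier 1 is admissible; integrability of \<open>g\<close> is what makes
    the inversion formula applicable to \<open>v\<close>.\<close>
  have g1: "integrable lborel g"
  proof -
    have "1 \<le> (1 + \<xi>\<^sup>2) powr (\<alpha> / 2)" for \<xi> :: real using assms(1) by (intro ge_one_powr_ge_zero) auto
    then show ?thesis
      using integrable_sobolev_multiplier[OF _ _ _ S, of "\<lambda>_. 1"] assms(1) by simp
  qed
  have h1: "integrable lborel (h \<alpha>)"
    unfolding h_def[abs_def] using assms(1)
    by (intro integrable_sobolev_multiplier[OF _ _ _ S]) (auto intro: abs_powr_le_weight)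
  define w where "w = frac_deriv_real \<alpha> v"
  define z where "z = frac_deriv_real (2 * \<alpha>) v"
  have Re_sq: "square_integrable (\<lambda>x. complex_of_real (frac_deriv_real \<beta> v x))" if "0 \<le> \<beta>" "\<beta> \<le> 2 * \<alpha>" for \<beta>
  proof -
    have u: "square_integrable (frac_deriv \<beta> ?v)" using inv[OF that] by (simp add: has_inv_fourier_def)
    have [measurable]: "frac_deriv \<beta> ?v \<in> borel_measurable borel" using u by auto
    show ?thesis
      unfolding frac_deriv_real_def by (rule square_integrable_bound[OF u]) (auto simp: abs_Re_le_cmod)
  qed
  have w2: "square_integrable (\<lambda>x. complex_of_real (w x))" and z2: "square_integrable (\<lambda>x. complex_of_real (z x))"
    using assms(1) Re_sq by (auto simp: w_def z_def)
  have pairing: "(LINT x|lborel. v x * frac_deriv_real \<beta> v x) = (LINT \<xi>|lborel. \<bar>\<xi>\<bar> powr \<beta> * (cmod (g \<xi>))\<^sup>2) / (2 * pi)"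
    if "0 \<le> \<beta>" "\<beta> \<le> 2 * \<alpha>" for \<beta>
    unfolding frac_deriv_real_def by (rule frac_deriv_pairing[OF vg]) (use inv[OF that] in \<open>simp add: h_def[abs_def]\<close>)

  \<comment> \<open>By inversion, the L1 norm of \<open>g\<close> bounds \<open>v\<close> almost
    everywhere. With \<open>v\<close> square integrable, every power of exponent at least 2 is then
    integrable.\<close>
  define b where "b = (LINT \<xi>|lborel. cmod (g \<xi>)) / (2 * pi)"
  have bounded: "AE x in lborel. \<bar>v x\<bar> \<le> b"
    using Fourier_inversion[OF vg g1]
  proof eventually_elim
    fix x assume "?v x = FT g (- x) / of_real (2 * pi)"
    then have "cmod (?v x) = cmod (FT g (- x)) / (2 * pi)" by (simp add: norm_divide)
    also have "\<dots> \<le> b" unfolding b_def by (intro divide_right_mono norm_FT_le) simp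
    finally show "\<bar>v x\<bar> \<le> b" by simp
  qed
  have vsq: "integrable lborel (\<lambda>x. (v x)\<^sup>2)" using v2 by (simp add: square_integrable_def)
  have vpow: "integrable lborel (\<lambda>x. v x ^ (n + 2))" for n
  proof (rule Bochner_Integration.integrable_bound)
    show "integrable lborel (\<lambda>x. b ^ n * (v x)\<^sup>2)" using vsq by simp
    show "AE x in lborel. norm (v x ^ (n + 2)) \<le> norm (b ^ n * (v x)\<^sup>2)"
      using bounded
    proof eventually_elim
      fix x assume "\<bar>v x\<bar> \<le> b"
      then have "\<bar>v x\<bar> ^ n \<le> \<bar>b\<bar> ^ n" by (intro power_mono) auto
      then show "norm (v x ^ (n + 2)) \<le> norm (b ^ n * (v x)\<^sup>2)"
        unfolding power_add by (simp add: abs_mult power_abs mult_right_mono)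
    qed
  qed measurable
  \<comment> \<open>As \<open>0 < k\<close>, the exponent \<open>k + 1\<close> is at least 2, so
    \<open>vpow\<close> makes \<open>v x ^ (k + 1)\<close> integrable; the positivity of
    \<open>X\<close> relies on this.\<close>
  obtain k' where k': "k + 1 = k' + 2"
    by (rule that[of "k - 1"]) (use assms(4) in simp)
  have p2: "square_integrable (\<lambda>x. complex_of_real (v x ^ (k + 1)))"
  proof -
    have "(cmod (complex_of_real (v x ^ (k + 1))))\<^sup>2 = v x ^ (2 * k + 2)" for x
      unfolding norm_of_real power2_abs power_mult[symmetric] by (simp add: mult.commute)
    then show ?thesis using vpow[of "2 * k"] by (simp only: square_integrable_def) simp
  qed

  define s where "s = sqrt (1 + \<alpha>)"
  have s2: "s\<^sup>2 = \<alpha> + 1" using assms(1) by (simp add: s_def)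
  have s1: "1 \<le> s" using assms(1) by (simp add: s_def)
  have sk: "s \<le> real k + 1"
  proof -
    have "s \<le> sqrt (2\<^sup>2)" unfolding s_def using assms(2) by (intro real_sqrt_le_mono) simp
    then show ?thesis using assms(4) by simp
  qed
  define M where "M = (LINT x|lborel. (v x)\<^sup>2)"
  define A where "A = (LINT x|lborel. v x * w x)"
  define B where "B = (LINT x|lborel. v x ^ (k + 2))"
  define W where "W = (LINT x|lborel. (w x)\<^sup>2)"
  define X where "X = (LINT x|lborel. v x ^ (k + 1) * w x)"
  define Q where "Q = (LINT x|lborel. v x ^ (2 * k + 2))"
  define Z where "Z = (LINT x|lborel. v x * z x)"
  note vw = integrable_mult_L2_real[OF v2 w2] and vz = integrable_mult_L2_real[OF v2 z2]
    and pw = integrable_mult_L2_real[OF p2 w2]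
  have wsq: "integrable lborel (\<lambda>x. (w x)\<^sup>2)" using w2 by (simp add: square_integrable_def)

  have mass: "(LINT x|lborel. mass_density v x) = M"
    by (simp add: mass_density_def M_def)
  have mcur: "(LINT x|lborel. mass_current \<alpha> k v x) = (\<alpha> + 1) * A + 2 * (real k + 1) / (real k + 2) * B"
  proof -
    have "mass_current \<alpha> k v x = (\<alpha> + 1) * (v x * w x) + 2 * (real k + 1) / (real k + 2) * v x ^ (k + 2)" for x
      by (simp only: mass_current_def w_def mult.assoc)
    then show ?thesis using vw vpow[of k] by (simp add: A_def B_def)
  qed
  have eden: "(LINT x|lborel. energy_density \<alpha> k v x) = 1 / 2 * A + 1 / (real k + 2) * B"
  proof -
    have "energy_density \<alpha> k v x = 1 / 2 * (v x * w x) + 1 / (real k + 2) * v x ^ (k + 2)" for x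
      by (simp only: energy_density_def w_def mult.assoc)
    then show ?thesis using vw vpow[of k] by (simp add: A_def B_def)
  qed
  have ecur: "(LINT x|lborel. energy_current \<alpha> k v x) = (\<alpha> + 1) / 2 * Z + (\<alpha> + 2) / 2 * X + 1 / 2 * Q"
  proof -
    have "energy_current \<alpha> k v x = (\<alpha> + 1) / 2 * (v x * z x) + (\<alpha> + 2) / 2 * (v x ^ (k + 1) * w x) + 1 / 2 * v x ^ (2 * k + 2)" for x
      by (simp only: energy_current_def w_def z_def mult.assoc)
    then show ?thesis using vz pw vpow[of "2 * k"] by (simp add: X_def Z_def Q_def)
  qed

  have "0 \<le> M" by (simp add: M_def)
  moreover have "0 \<le> B"
    unfolding B_def by (intro Bochner_Integration.integral_nonneg zero_le_even_power) (use assms(3) in simp)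
  moreover have "0 \<le> A"
    using pairing[of \<alpha>] assms(1) by (simp add: A_def w_def integral_nonneg)
  \<comment> \<open>The positivity result is used with the even exponent \<open>n = k + 2\<close>,
    so that \<open>n - 1 = k + 1\<close>.\<close>
  moreover have "0 \<le> X"
    using integral_power_frac_deriv_nonneg[OF vg g1 _ _ _ assms(2), of "frac_deriv \<alpha> ?v" "k + 2"]
      inv[of \<alpha>] h1 assms vpow[of k] vpow[of k'] k'
    by (simp add: X_def w_def frac_deriv_real_def h_def[abs_def])
  moreover have "W \<le> Z"
  \<comment> \<open>The squared modulus of the symbol of order \<alpha> is the symbol of order
    \<open>2 * \<alpha>\<close>, so the Bessel bound for \<open>h \<alpha>\<close> is the frequency
    form of \<open>Z\<close>.\<close>
  proof -
    have "W \<le> (LINT \<xi>|lborel. (cmod (h \<alpha> \<xi>))\<^sup>2) / (2 * pi)"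
      unfolding W_def w_def frac_deriv_real_def
      by (rule integral_Re_inv_fourier_le[OF inv h1]) (use assms(1) in auto)
    also have "(\<lambda>\<xi>. (cmod (h \<alpha> \<xi>))\<^sup>2) = (\<lambda>\<xi>. \<bar>\<xi>\<bar> powr (2 * \<alpha>) * (cmod (g \<xi>))\<^sup>2)"
      by (simp add: h_def norm_mult power_mult_distrib power2_eq_square[of "_ powr _"] flip: powr_add)
    also have "(LINT \<xi>|lborel. \<bar>\<xi>\<bar> powr (2 * \<alpha>) * (cmod (g \<xi>))\<^sup>2) / (2 * pi) = Z"
      using pairing[of "2 * \<alpha>"] assms(1) by (simp add: Z_def z_def)
    finally show ?thesis .
  qed
  moreover have "(s * A + B)\<^sup>2 \<le> M * (s\<^sup>2 * W + 2 * s * X + Q)"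
  \<comment> \<open>Cauchy-Schwarz for \<open>v\<close> and \<open>s * w x + v x ^ (k + 1)\<close>;
    the factor \<open>s\<close> is chosen so that \<open>s\<^sup>2 = \<alpha> + 1\<close> matches,
    up to the common factor 1/2, the leading coefficient of the energy current.\<close>
  proof -
    have q: "square_integrable (\<lambda>x. complex_of_real (s * w x + v x ^ (k + 1)))"
      using square_integrable_add[OF square_integrable_cmult[OF w2, of "of_real s"] p2] by simp
    have "(\<lambda>x. v x * (s * w x + v x ^ (k + 1))) = (\<lambda>x. s * (v x * w x) + v x ^ (k + 2))"
      by (simp add: algebra_simps)
    then have "(LINT x|lborel. v x * (s * w x + v x ^ (k + 1))) = s * A + B"
      using vw vpow[of k] by (simp add: A_def B_def)
    moreover have "(s * w x + v x ^ (k + 1))\<^sup>2 = s\<^sup>2 * (w x)\<^sup>2 + 2 * s * (v x ^ (k + 1) * w x) + v x ^ (2 * k + 2)" for x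
    proof -
      have "v x ^ (2 * k + 2) = (v x ^ (k + 1))\<^sup>2"
        unfolding power_mult[symmetric] by (simp add: mult.commute)
      then show ?thesis by (simp only: power2_sum power_mult_distrib mult_ac)
    qed
    then have "(LINT x|lborel. (s * w x + v x ^ (k + 1))\<^sup>2) = s\<^sup>2 * W + 2 * s * X + Q"
      using wsq pw vpow[of "2 * k"] by (simp add: W_def X_def Q_def)
    ultimately show ?thesis
      using Cauchy_Schwarz_L2_real[OF v2 q] by (simp add: M_def)
  qed
  ultimately have "(real k)\<^sup>2 / (2 * (real k + 2)\<^sup>2) * B\<^sup>2 \<le>
      M * (s\<^sup>2 / 2 * Z + (s\<^sup>2 + 1) / 2 * X + 1 / 2 * Q)
      - (1 / 2 * A + 1 / (real k + 2) * B) * (s\<^sup>2 * A + 2 * (real k + 1) / (real k + 2) * B)"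
    using s1 sk assms(4) by (intro current_inequality) auto
  then show ?thesis
    unfolding mass mcur eden ecur s2 B_def[symmetric] by (simp add: add.assoc)
qed

end
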